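(* For each finite graph $\Gamma$, there exists a finite tree $T$ such that $G(\Gamma)$ admits a quasi-isometric group embedding into $G(T)$.
   Context: All graphs are simplicial (no loops, no multiple edges). For a finite graph $\Gamma$ with vertex set $V(\Gamma)$ and edge set $E(\Gamma)$, the right-angled Artin group $G(\Gamma)$ is defined with the OPPOSITE of the usual convention: it is generated by $V(\Gamma)$, and two distinct vertices commute exactly when they are NOT adjacent, i.e. $G(\Gamma)=\langle V(\Gamma)\mid [v_i,v_j]=1 \text{ if and only if } \{v_i,v_j\}\notin E(\Gamma)\rangle$. For groups $G,H$ equipped with metrics $d_G,d_H$, a quasi-isometric group embedding from $G$ to $H$ is an injective group homomorphism $f\colon G\to H$ for which there is a constant $C>0$ such that $d_G(x,y)/C-C\le d_H(f(x),f(y))\le C\,d_G(x,y)+C$ for all $x,y\in G$. Finitely generated groups are equipped with word metrics (with respect to finite generating sets). *)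

theory Defs
  imports "Graph_Theory.Graph_Theory" "HOL-Algebra.Algebra"
begin

section \<open>Trees\<close>

text \<open>
  A finite simplicial graph is a \<^term>\<open>pair_graph\<close>: a finite, symmetric, loop-free digraph
  without parallel arcs, where the edge joining u and v is the pair of arcs (u, v) and (v, u).
  The constant \<^const>\<open>tree\<close> is not suitable for such graphs, because \<^const>\<open>pre_digraph.cycle\<close>
  also counts the closed walk u, v, u running back and forth along one edge. The cycles of the
  undirected graph are those of length at least three.
\<close>

definition finite_tree :: "'a pair_pre_digraph \<Rightarrow> bool" where
  "finite_tree T \<longleftrightarrow> pair_graph T \<and> connected (with_proj T) \<and>
     \<not> (\<exists>p. pre_digraph.cycle (with_proj T) p \<and> 3 \<le> length p)"

section \<open>Group presentations\<close>

text \<open>The letter (s, True) stands for the generator s, and (s, False) for its formal inverse.\<close>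

type_synonym 'a word = "('a \<times> bool) list"

definition words :: "'a set \<Rightarrow> 'a word set" where
  "words S = lists (S \<times> UNIV)"

text \<open>
  The least congruence on words over S that contains the free cancellations and identifies
  each relator in R with the empty word.
\<close>

inductive_set pres_rel :: "'a set \<Rightarrow> 'a word set \<Rightarrow> ('a word \<times> 'a word) set"
  for S :: "'a set" and R :: "'a word set" where
  refl: "w \<in> words S \<Longrightarrow> (w, w) \<in> pres_rel S R"
| sym: "(v, w) \<in> pres_rel S R \<Longrightarrow> (w, v) \<in> pres_rel S R"
| trans: "(u, v) \<in> pres_rel S R \<Longrightarrow> (v, w) \<in> pres_rel S R \<Longrightarrow> (u, w) \<in> pres_rel S R"
| cancel: "u \<in> words S \<Longrightarrow> v \<in> words S \<Longrightarrow> s \<in> S \<Longrightarrow>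
    (u @ [(s, b), (s, \<not> b)] @ v, u @ v) \<in> pres_rel S R"
| relator: "u \<in> words S \<Longrightarrow> v \<in> words S \<Longrightarrow> r \<in> R \<Longrightarrow> r \<in> words S \<Longrightarrow>
    (u @ r @ v, u @ v) \<in> pres_rel S R"

definition presented_group :: "'a set \<Rightarrow> 'a word set \<Rightarrow> 'a word set monoid" where
  "presented_group S R =
     \<lparr>carrier = words S // pres_rel S R,
      mult = (\<lambda>A B. \<Union>a\<in>A. \<Union>b\<in>B. pres_rel S R `` {a @ b}),
      one = pres_rel S R `` {[]}\<rparr>"

section \<open>Right-angled Artin groups\<close>

definition commutator_word :: "'a \<Rightarrow> 'a \<Rightarrow> 'a word" where
  "commutator_word u v = [(u, True), (v, True), (u, False), (v, False)]"

text \<open>Opposite of the usual convention: vertices commute when they are \<^emph>\<open>not\<close> adjacent.\<close>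

definition raag_relators :: "'a pair_pre_digraph \<Rightarrow> 'a word set" where
  "raag_relators \<Gamma> = {commutator_word u v | u v.
     u \<in> pverts \<Gamma> \<and> v \<in> pverts \<Gamma> \<and> u \<noteq> v \<and> (u, v) \<notin> parcs \<Gamma>}"

definition raag :: "'a pair_pre_digraph \<Rightarrow> 'a word set monoid" where
  "raag \<Gamma> = presented_group (pverts \<Gamma>) (raag_relators \<Gamma>)"

definition raag_gen :: "'a pair_pre_digraph \<Rightarrow> 'a \<Rightarrow> 'a word set" where
  "raag_gen \<Gamma> v = pres_rel (pverts \<Gamma>) (raag_relators \<Gamma>) `` {[(v, True)]}"

section \<open>Word metrics and quasi-isometric group embeddings\<close>

definition finite_generating_set :: "('a, 'b) monoid_scheme \<Rightarrow> 'a set \<Rightarrow> bool" where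
  "finite_generating_set G S \<longleftrightarrow> finite S \<and> S \<subseteq> carrier G \<and> generate G S = carrier G"

definition word_length :: "('a, 'b) monoid_scheme \<Rightarrow> 'a set \<Rightarrow> 'a \<Rightarrow> nat" where
  "word_length G S x =
     (LEAST n. \<exists>xs. set xs \<subseteq> S \<union> m_inv G ` S \<and> length xs = n \<and>
        foldr (mult G) xs (one G) = x)"

definition word_metric :: "('a, 'b) monoid_scheme \<Rightarrow> 'a set \<Rightarrow> 'a \<Rightarrow> 'a \<Rightarrow> real" where
  "word_metric G S x y = real (word_length G S (mult G (m_inv G x) y))"

definition qi_group_embedding ::
  "('a, 'c) monoid_scheme \<Rightarrow> ('a \<Rightarrow> 'a \<Rightarrow> real) \<Rightarrow>
   ('b, 'd) monoid_scheme \<Rightarrow> ('b \<Rightarrow> 'b \<Rightarrow> real) \<Rightarrow> ('a \<Rightarrow> 'b) \<Rightarrow> bool" where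
  "qi_group_embedding G dG H dH f \<longleftrightarrow> f \<in> mon G H \<and>
     (\<exists>C>0. \<forall>x\<in>carrier G. \<forall>y\<in>carrier G.
        dG x y / C - C \<le> dH (f x) (f y) \<and> dH (f x) (f y) \<le> C * dG x y + C)"

section \<open>Presented groups are groups\<close>

lemma words_Nil [simp]: "[] \<in> words S"
  and words_Cons [simp]: "x # u \<in> words S \<longleftrightarrow> fst x \<in> S \<and> u \<in> words S"
  and words_append [simp]: "u @ v \<in> words S \<longleftrightarrow> u \<in> words S \<and> v \<in> words S"
  by (cases x; auto simp: words_def)+

lemma pres_rel_words: "(v, w) \<in> pres_rel S R \<Longrightarrow> v \<in> words S \<and> w \<in> words S"
  by (induction rule: pres_rel.induct) auto

lemma equiv_pres_rel: "equiv (words S) (pres_rel S R)"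
proof (rule equivI)
  show "pres_rel S R \<subseteq> words S \<times> words S"
    using pres_rel_words by fast
  show "refl_on (words S) (pres_rel S R)"
    by (simp add: refl_on_def pres_rel.refl)
  show "Relation.sym (pres_rel S R)"
    by (rule symI) (rule pres_rel.sym)
  show "Relation.trans (pres_rel S R)"
    by (rule transI) (rule pres_rel.trans)
qed

lemma pres_rel_context:
  assumes "(v, w) \<in> pres_rel S R" "a \<in> words S" "b \<in> words S"
  shows "(a @ v @ b, a @ w @ b) \<in> pres_rel S R"
  using assms
proof (induction rule: pres_rel.induct)
  case (refl w)
  then show ?case by (simp add: pres_rel.refl)
next
  case (sym v w)
  then show ?case by (blast intro: pres_rel.sym)
next
  case (trans u v w)
  then show ?case by (blast intro: pres_rel.trans)
next
  case (cancel u v s c)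
  then show ?case using pres_rel.cancel[of "a @ u" S "v @ b" s c R] by simp
next
  case (relator u v r)
  then show ?case using pres_rel.relator[of "a @ u" S "v @ b" r R] by simp
qed

lemma pres_rel_append:
  assumes "(a, a') \<in> pres_rel S R" "(b, b') \<in> pres_rel S R"
  shows "(a @ b, a' @ b') \<in> pres_rel S R"
  using pres_rel_context[OF assms(1), of "[]" b] pres_rel_context[OF assms(2), of a' "[]"]
    pres_rel_words[OF assms(1)] pres_rel_words[OF assms(2)]
  by simp (rule pres_rel.trans)

lemma presented_group_mult:
  assumes "a \<in> words S" "b \<in> words S"
  shows "mult (presented_group S R) (pres_rel S R `` {a}) (pres_rel S R `` {b})
    = pres_rel S R `` {a @ b}"
proof -
  have "congruent2 (pres_rel S R) (pres_rel S R) (\<lambda>a b. pres_rel S R `` {a @ b})"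
    unfolding congruent2_def
    by (auto intro!: equiv_class_eq[OF equiv_pres_rel] pres_rel_append)
  from UN_equiv_class2[OF equiv_pres_rel equiv_pres_rel this assms] show ?thesis
    by (simp add: presented_group_def)
qed

definition inv_word :: "'a word \<Rightarrow> 'a word" where
  "inv_word w = rev (map (\<lambda>(s, b). (s, \<not> b)) w)"

lemma inv_word_words: "w \<in> words S \<Longrightarrow> inv_word w \<in> words S"
  by (auto simp: inv_word_def words_def)

lemma pres_rel_inv_word:
  assumes "w \<in> words S" shows "(inv_word w @ w, []) \<in> pres_rel S R"
  using assms
proof (induction w)
  case Nil
  then show ?case by (simp add: inv_word_def pres_rel.refl)
next
  case (Cons x w)
  obtain s b where x: "x = (s, b)" by fastforce
  have "(inv_word w @ [(s, \<not> b), (s, \<not> \<not> b)] @ w, inv_word w @ w) \<in> pres_rel S R"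
    by (rule pres_rel.cancel) (use Cons.prems x in \<open>auto simp: inv_word_words\<close>)
  then have "(inv_word (x # w) @ x # w, inv_word w @ w) \<in> pres_rel S R"
    by (simp add: x inv_word_def)
  moreover have "(inv_word w @ w, []) \<in> pres_rel S R"
    using Cons by simp
  ultimately show ?case by (rule pres_rel.trans)
qed

lemma group_presented_group: "group (presented_group S R)"
proof (rule groupI)
  let ?G = "presented_group S R" and ?c = "\<lambda>w. pres_rel S R `` {w}"
  have car: "carrier ?G = ?c ` words S"
    by (auto simp: presented_group_def quotient_def)
  have one: "\<one>\<^bsub>?G\<^esub> = ?c []"
    by (simp add: presented_group_def)
  show "\<one>\<^bsub>?G\<^esub> \<in> carrier ?G"
    by (simp add: car one)
  show "x \<otimes>\<^bsub>?G\<^esub> y \<in> carrier ?G" if "x \<in> carrier ?G" "y \<in> carrier ?G" for x y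
    using that by (auto simp: car presented_group_mult)
  show "x \<otimes>\<^bsub>?G\<^esub> y \<otimes>\<^bsub>?G\<^esub> z = x \<otimes>\<^bsub>?G\<^esub> (y \<otimes>\<^bsub>?G\<^esub> z)"
    if "x \<in> carrier ?G" "y \<in> carrier ?G" "z \<in> carrier ?G" for x y z
    using that by (auto simp: car presented_group_mult)
  show "\<one>\<^bsub>?G\<^esub> \<otimes>\<^bsub>?G\<^esub> x = x" if "x \<in> carrier ?G" for x
    using that by (auto simp: car one presented_group_mult)
  show "\<exists>y\<in>carrier ?G. y \<otimes>\<^bsub>?G\<^esub> x = \<one>\<^bsub>?G\<^esub>" if "x \<in> carrier ?G" for x
  proof -
    from that obtain w where w: "w \<in> words S" "x = ?c w" by (auto simp: car)
    have "?c (inv_word w) \<otimes>\<^bsub>?G\<^esub> x = ?c (inv_word w @ w)"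
      using w by (simp add: presented_group_mult inv_word_words)
    also have "\<dots> = \<one>\<^bsub>?G\<^esub>"
      unfolding one by (rule equiv_class_eq[OF equiv_pres_rel pres_rel_inv_word[OF w(1)]])
    finally show ?thesis using w by (auto simp: car inv_word_words)
  qed
qed

lemma generate_presented_group:
  "generate (presented_group S R) ((\<lambda>s. pres_rel S R `` {[(s, True)]}) ` S)
     = carrier (presented_group S R)" (is "generate ?G ?X = _")
proof
  interpret group ?G by (rule group_presented_group)
  let ?c = "\<lambda>w. pres_rel S R `` {w}"
  have car: "carrier ?G = ?c ` words S"
    by (auto simp: presented_group_def quotient_def)
  have one: "\<one>\<^bsub>?G\<^esub> = ?c []"
    by (simp add: presented_group_def)
  have X: "?X \<subseteq> carrier ?G" by (auto simp: car)
  show "generate ?G ?X \<subseteq> carrier ?G"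
    using generate_incl[OF X] .
  have letter: "?c [(s, b)] \<in> generate ?G ?X" if s: "s \<in> S" for s b
  proof (cases b)
    case True
    with s show ?thesis by (auto intro: generate.incl)
  next
    case False
    have "([(s, False), (s, True)], []) \<in> pres_rel S R"
      using pres_rel.cancel[of "[]" S "[]" s False R] s by simp
    then have "?c [(s, False)] \<otimes>\<^bsub>?G\<^esub> ?c [(s, True)] = \<one>\<^bsub>?G\<^esub>"
      using s by (simp add: presented_group_mult one equiv_class_eq[OF equiv_pres_rel])
    then have "inv\<^bsub>?G\<^esub> (?c [(s, True)]) = ?c [(s, False)]"
      by (rule inv_equality) (use s in \<open>auto simp: car\<close>)
    moreover have "inv\<^bsub>?G\<^esub> (?c [(s, True)]) \<in> generate ?G ?X"
      using s by (intro generate.inv imageI)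
    ultimately show ?thesis using False by simp
  qed
  have "?c w \<in> generate ?G ?X" if "w \<in> words S" for w
    using that
  proof (induction w)
    case Nil
    then show ?case using generate.one[of ?G ?X] by (simp add: one)
  next
    case (Cons x w)
    obtain s b where x: "x = (s, b)" by fastforce
    have "?c [x] \<otimes>\<^bsub>?G\<^esub> ?c w \<in> generate ?G ?X"
    proof (rule generate.eng)
      show "?c [x] \<in> generate ?G ?X" using letter[of s b] Cons.prems by (simp add: x)
      show "?c w \<in> generate ?G ?X" using Cons by simp
    qed
    with Cons.prems show ?case by (simp add: presented_group_mult)
  qed
  then show "carrier ?G \<subseteq> generate ?G ?X" by (auto simp: car)
qed

lemma group_raag: "group (raag \<Gamma>)"
  by (simp add: raag_def group_presented_group)

lemma finite_generating_set_raag: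
  assumes "pair_graph \<Gamma>"
  shows "finite_generating_set (raag \<Gamma>) (raag_gen \<Gamma> ` pverts \<Gamma>)"
proof -
  interpret pair_graph \<Gamma> by fact
  show ?thesis
    unfolding finite_generating_set_def raag_def raag_gen_def
    by (intro conjI generate_presented_group)
      (auto simp: presented_group_def intro!: quotientI)
qed

end

theory Submission
  imports Defs
begin

text \<open>
  Let T be the tree whose vertices are the simple paths of \<open>\<Gamma>\<close>, including the empty path as the
  root, where a path is joined to its one-vertex extensions. Label a non-empty path by its last
  vertex, and send a vertex s of \<open>\<Gamma>\<close> to the product of the paths labelled s. Adjacent non-empty
  paths have adjacent labels, so the paths with label s commute, and so do the images of
  commuting vertices; this defines a homomorphism \<open>raag \<Gamma> \<rightarrow> raag T\<close>. The claim is that it does not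
  decrease the length with respect to the standard generators, which gives both injectivity and
  the lower quasi-isometry bound; the other bound holds for every homomorphism.

  Fix a vertex v and regard the group as an HNN extension with stable letter v, whose base group
  K is generated by the other vertices and whose associated subgroup H is generated by those
  that commute with v. A word is pinch-free at v if no subword \<open>v\<^sup>e x v\<^sup>-\<^sup>e\<close> has \<open>x \<in> H\<close>. By the
  normal form theorem for HNN extensions, no word for the same element has fewer letters v
  (\<open>pinch_free_minimal\<close>). Shortest words are pinch-free at all vertices simultaneously
  (\<open>shortest_imp_pinch_free\<close>), since deleting from \<open>x \<in> H\<close> the letters outside H does not change the
  element and lets the two letters v cancel.

  The heart of the proof is \<open>occurrences_le_unfolds\<close>. Consider the simple paths starting at v in a
  set A of vertices, with root the path \<open>t = [v]\<close>. If w is pinch-free at v, then its image in the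
  group of this rooted tree is pinch-free at t, so that all letters t survive. Indeed, let x lie
  between two opposite letters v of w. A shortest word for x contains a neighbour u of v. The
  paths starting with v, u form a copy of the same kind of tree for u in \<open>A - {v}\<close>, rooted at a
  neighbour t' of t; by induction t' survives in the image of x, which therefore does not lie in
  the subgroup generated by the vertices that commute with t. Simple paths are exactly what this
  induction needs, because x does not contain v. Applying this to a shortest word w and to the
  path [v] for every vertex v, and adding up the occurrences, gives the claim.
\<close>

section \<open>Words in right-angled Artin groups\<close>

text \<open>
  Equality in the right-angled Artin group of the graph that the set E of noncommuting pairs
  induces on the vertex set A, as a relation on words.
\<close>

definition raag_eq :: "('a \<times> 'a) set \<Rightarrow> 'a set \<Rightarrow> ('a word \<times> 'a word) set" where
  "raag_eq E A = pres_rel A {commutator_word u v | u v. u \<in> A \<and> v \<in> A \<and> u \<noteq> v \<and> (u, v) \<notin> E}"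

lemma pres_rel_raag_relators: "pres_rel (pverts \<Gamma>) (raag_relators \<Gamma>) = raag_eq (parcs \<Gamma>) (pverts \<Gamma>)"
  by (simp add: raag_eq_def raag_relators_def)

lemma words_iff: "w \<in> words S \<longleftrightarrow> fst ` set w \<subseteq> S"
  by (induction w) auto

lemma words_mono: "w \<in> words S \<Longrightarrow> S \<subseteq> S' \<Longrightarrow> w \<in> words S'"
  by (auto simp: words_iff)

lemma concat_map_words:
  assumes "w \<in> words S" "\<And>x. fst x \<in> S \<Longrightarrow> h x \<in> words B"
  shows "concat (map h w) \<in> words B"
  using assms(1) by (induction w) (auto simp: assms(2))

text \<open>The universal property of a presentation, on the level of words.\<close>

lemma pres_rel_subst:
  assumes "(v, w) \<in> pres_rel S R"
    and h: "\<And>x. fst x \<in> S \<Longrightarrow> h x \<in> words B"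
    and inv: "\<And>s b. s \<in> S \<Longrightarrow> (h (s, b) @ h (s, \<not> b), []) \<in> pres_rel B Q"
    and rel: "\<And>r. r \<in> R \<Longrightarrow> r \<in> words S \<Longrightarrow> (concat (map h r), []) \<in> pres_rel B Q"
  shows "(concat (map h v), concat (map h w)) \<in> pres_rel B Q"
  using assms(1)
proof (induction rule: pres_rel.induct)
  case (refl w)
  then show ?case by (intro pres_rel.refl concat_map_words h)
next
  case (sym v w)
  then show ?case by (blast intro: pres_rel.sym)
next
  case (trans u v w)
  then show ?case by (blast intro: pres_rel.trans)
next
  case (cancel u v s b)
  then show ?case
    using pres_rel_context[OF inv[of s b], of "concat (map h u)" "concat (map h v)"]
      concat_map_words[of u S h B] concat_map_words[of v S h B] h by simp
next
  case (relator u v r)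
  then show ?case
    using pres_rel_context[OF rel[of r], of "concat (map h u)" "concat (map h v)"]
      concat_map_words[of u S h B] concat_map_words[of v S h B] h by simp
qed

lemma pres_rel_cancel2:
  assumes "s \<in> S"
  shows "([(s, b), (s, \<not> b)], []) \<in> pres_rel S R"
  using pres_rel.cancel[of "[]" S "[]" s b R] assms by simp

lemma pres_rel_commute_inverse:
  assumes pq: "([(x, a), q], [q, (x, a)]) \<in> pres_rel S R"
  shows "([(x, \<not> a), q], [q, (x, \<not> a)]) \<in> pres_rel S R"
proof -
  have S: "x \<in> S" "fst q \<in> S"
    using pres_rel_words[OF pq] by auto
  have "([(x, \<not> a), q] @ [(x, a), (x, \<not> a)], [(x, \<not> a), q] @ []) \<in> pres_rel S R"
    using pres_rel.cancel[of "[(x, \<not> a), q]" S "[]" x a R] S by simp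
  moreover have "([(x, \<not> a)] @ [(x, a), q] @ [(x, \<not> a)], [(x, \<not> a)] @ [q, (x, a)] @ [(x, \<not> a)])
      \<in> pres_rel S R"
    by (rule pres_rel_context[OF pq]) (use S in auto)
  moreover have "([] @ [(x, \<not> a), (x, \<not> \<not> a)] @ [q, (x, \<not> a)], [] @ [q, (x, \<not> a)]) \<in> pres_rel S R"
    by (rule pres_rel.cancel) (use S in auto)
  ultimately show ?thesis
    by simp (meson pres_rel.sym pres_rel.trans)
qed

lemma pres_rel_commute_letters:
  assumes S: "x \<in> S" "y \<in> S" and R: "x \<noteq> y \<Longrightarrow> commutator_word x y \<in> R"
  shows "([(x, a), (y, b)], [(y, b), (x, a)]) \<in> pres_rel S R"
proof (cases "x = y")
  case True
  show ?thesis
  proof (cases "a = b")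
    case True
    with \<open>x = y\<close> S show ?thesis by (simp add: pres_rel.refl)
  next
    case False
    then have "b = (\<not> a)" by simp
    with \<open>x = y\<close> show ?thesis
      using pres_rel_cancel2[of x S a R] pres_rel_cancel2[of x S b R] S
      by simp (meson pres_rel.sym pres_rel.trans)
  qed
next
  case False
  let ?X = "(x, True)" and ?Y = "(y, True)"
  have XY: "([?X, ?Y], [?Y, ?X]) \<in> pres_rel S R"
  proof -
    have "([?X, ?Y] @ [(x, False), (x, \<not> False)] @ [], [?X, ?Y] @ []) \<in> pres_rel S R"
      by (rule pres_rel.cancel) (use S in auto)
    moreover have "([?X, ?Y, (x, False)] @ [(y, False), (y, \<not> False)] @ [?X],
        [?X, ?Y, (x, False)] @ [?X]) \<in> pres_rel S R"
      by (rule pres_rel.cancel) (use S in auto)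
    moreover have "([] @ commutator_word x y @ [?Y, ?X], [] @ [?Y, ?X]) \<in> pres_rel S R"
      by (rule pres_rel.relator) (use S False R in \<open>auto simp: commutator_word_def\<close>)
    ultimately show ?thesis
      by (simp add: commutator_word_def) (meson pres_rel.sym pres_rel.trans)
  qed
  have *: "([(x, a), ?Y], [?Y, (x, a)]) \<in> pres_rel S R"
    using XY pres_rel_commute_inverse[OF XY] by (cases a) auto
  show ?thesis
    using * pres_rel.sym[OF pres_rel_commute_inverse[OF pres_rel.sym[OF *]]] by (cases b) auto
qed

lemma pres_rel_commute_words:
  assumes "u \<in> words S" "w \<in> words S"
    and "\<And>p q. p \<in> set u \<Longrightarrow> q \<in> set w \<Longrightarrow> ([p, q], [q, p]) \<in> pres_rel S R"
  shows "(u @ w, w @ u) \<in> pres_rel S R"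
proof -
  have letter: "(p # w, w @ [p]) \<in> pres_rel S R"
    if "fst p \<in> S" "w \<in> words S" "\<And>q. q \<in> set w \<Longrightarrow> ([p, q], [q, p]) \<in> pres_rel S R" for p w
    using that(2,3)
  proof (induction w)
    case Nil
    then show ?case using that(1) by (simp add: pres_rel.refl)
  next
    case (Cons q w)
    have "([p, q] @ w, [q, p] @ w) \<in> pres_rel S R"
      using pres_rel_context[OF Cons.prems(2), of q "[]" w] Cons.prems(1) by simp
    moreover have "([q] @ (p # w) @ [], [q] @ (w @ [p]) @ []) \<in> pres_rel S R"
      by (rule pres_rel_context[OF Cons.IH]) (use Cons.prems in auto)
    ultimately show ?case by simp (meson pres_rel.trans)
  qed
  show ?thesis
    using assms(1,3)
  proof (induction u)
    case Nil
    then show ?case using assms(2) by (simp add: pres_rel.refl)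
  next
    case (Cons p u)
    have "([p] @ (u @ w) @ [], [p] @ (w @ u) @ []) \<in> pres_rel S R"
      by (rule pres_rel_context[OF Cons.IH]) (use Cons.prems in auto)
    moreover have "([] @ (p # w) @ u, [] @ (w @ [p]) @ u) \<in> pres_rel S R"
      by (rule pres_rel_context[OF letter]) (use Cons.prems assms(2) in auto)
    ultimately show ?case by simp (meson pres_rel.trans)
  qed
qed

section \<open>Standard subgroups and shortest words\<close>

lemma raag_eq_words: "(v, w) \<in> raag_eq E A \<Longrightarrow> v \<in> words A \<and> w \<in> words A"
  unfolding raag_eq_def by (rule pres_rel_words)

lemma raag_eq_refl: "w \<in> words A \<Longrightarrow> (w, w) \<in> raag_eq E A"
  unfolding raag_eq_def by (rule pres_rel.refl)

lemma raag_eq_sym: "(v, w) \<in> raag_eq E A \<Longrightarrow> (w, v) \<in> raag_eq E A"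
  unfolding raag_eq_def by (rule pres_rel.sym)

lemma raag_eq_trans [trans]:
  "(u, v) \<in> raag_eq E A \<Longrightarrow> (v, w) \<in> raag_eq E A \<Longrightarrow> (u, w) \<in> raag_eq E A"
  unfolding raag_eq_def by (rule pres_rel.trans)

lemma raag_eq_context:
  "(v, w) \<in> raag_eq E A \<Longrightarrow> a \<in> words A \<Longrightarrow> b \<in> words A \<Longrightarrow> (a @ v @ b, a @ w @ b) \<in> raag_eq E A"
  unfolding raag_eq_def by (rule pres_rel_context)

lemma raag_eq_commute_words:
  assumes "u \<in> words A" "w \<in> words A"
    and "\<And>x y. x \<in> fst ` set u \<Longrightarrow> y \<in> fst ` set w \<Longrightarrow> (x, y) \<notin> E"
  shows "(u @ w, w @ u) \<in> raag_eq E A"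
  unfolding raag_eq_def
proof (rule pres_rel_commute_words)
  fix p q assume pq: "p \<in> set u" "q \<in> set w"
  obtain x a y b where xy: "p = (x, a)" "q = (y, b)" by fastforce
  have "x \<in> A" "y \<in> A"
    using pq assms(1,2) by (auto simp: words_iff xy)
  moreover have "(x, y) \<notin> E"
    by (rule assms(3)) (use pq in \<open>force simp: xy\<close>)+
  ultimately show "([p, q], [q, p]) \<in> pres_rel A
      {commutator_word u v |u v. u \<in> A \<and> v \<in> A \<and> u \<noteq> v \<and> (u, v) \<notin> E}"
    unfolding xy by (intro pres_rel_commute_letters) blast+
qed (use assms in auto)

abbreviation restrict_word :: "'a set \<Rightarrow> 'a word \<Rightarrow> 'a word" where
  "restrict_word B w \<equiv> filter (\<lambda>x. fst x \<in> B) w"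

lemma restrict_word_words: "w \<in> words A \<Longrightarrow> restrict_word B w \<in> words (A \<inter> B)"
  by (auto simp: words_iff)

lemma restrict_word_id: "w \<in> words B \<Longrightarrow> restrict_word B w = w"
  by (force simp: words_iff filter_id_conv)

text \<open>
  For a set B of vertices, killing the generators outside B is a retraction onto the subgroup
  generated by B.
\<close>

lemma raag_eq_restrict:
  assumes vw: "(v, w) \<in> raag_eq E A" and "B \<subseteq> A"
  shows "(restrict_word B v, restrict_word B w) \<in> raag_eq E B"
proof -
  define h where "h = (\<lambda>x :: 'a \<times> bool. if fst x \<in> B then [x] else [])"
  have h: "concat (map h u) = restrict_word B u" for u
    by (induction u) (auto simp: h_def)
  have "(concat (map h v), concat (map h w)) \<in> raag_eq E B"
    unfolding raag_eq_def
  proof (rule pres_rel_subst[OF vw[unfolded raag_eq_def]])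
    fix r assume "r \<in> {commutator_word u v |u v. u \<in> A \<and> v \<in> A \<and> u \<noteq> v \<and> (u, v) \<notin> E}"
    then obtain x y where r: "r = commutator_word x y" "x \<noteq> y" "(x, y) \<notin> E" by blast
    have "commutator_word x y \<in> {commutator_word u v |u v. u \<in> B \<and> v \<in> B \<and> u \<noteq> v \<and> (u, v) \<notin> E}"
      if "x \<in> B" "y \<in> B"
      using that r by blast
    then have "(commutator_word x y, []) \<in> raag_eq E B" if "x \<in> B" "y \<in> B"
      using pres_rel.relator[of "[]" B "[]" r] that
      by (simp add: r raag_eq_def commutator_word_def)
    then show "(concat (map h r), []) \<in> pres_rel B
        {commutator_word u v |u v. u \<in> B \<and> v \<in> B \<and> u \<noteq> v \<and> (u, v) \<notin> E}"
      unfolding raag_eq_def[symmetric]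
      using pres_rel_cancel2[of x B True, folded raag_eq_def]
        pres_rel_cancel2[of y B True] raag_eq_refl[of "[]" B E]
      by (cases "x \<in> B"; cases "y \<in> B")
        (auto simp: h_def r(1) commutator_word_def raag_eq_def)
  next
    fix s b
    show "(h (s, b) @ h (s, \<not> b), []) \<in> pres_rel B
        {commutator_word u v |u v. u \<in> B \<and> v \<in> B \<and> u \<noteq> v \<and> (u, v) \<notin> E}"
      by (auto simp: h_def pres_rel_cancel2 pres_rel.refl)
  qed (auto simp: h_def)
  then show ?thesis by (simp add: h)
qed

lemma raag_eq_mono:
  assumes "(v, w) \<in> raag_eq E B" "B \<subseteq> A"
  shows "(v, w) \<in> raag_eq E A"
  using assms(1) unfolding raag_eq_def
proof (induction rule: pres_rel.induct)
  case (relator u v r)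
  then show ?case using assms(2) by (intro pres_rel.relator) (auto intro: words_mono)
next
  case (cancel u v s b)
  then show ?case using assms(2) by (intro pres_rel.cancel) (auto intro: words_mono)
qed (use assms(2) in \<open>blast intro: pres_rel.intros words_mono\<close>)+

text \<open>Words of least length among the words over A that represent the same element.\<close>

definition shortest :: "('a \<times> 'a) set \<Rightarrow> 'a set \<Rightarrow> 'a word \<Rightarrow> bool" where
  "shortest E A w \<longleftrightarrow> w \<in> words A \<and> (\<forall>z. (w, z) \<in> raag_eq E A \<longrightarrow> length w \<le> length z)"

lemma ex_shortest:
  assumes "w \<in> words A"
  obtains z where "(w, z) \<in> raag_eq E A" "shortest E A z"
proof -
  let ?P = "\<lambda>z. (w, z) \<in> raag_eq E A"
  define z where "z = arg_min length ?P"
  have z: "?P z" "\<And>y. ?P y \<Longrightarrow> length z \<le> length y"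
    using arg_min_nat_lemma[of ?P w length] raag_eq_refl[OF assms] by (auto simp: z_def)
  then have "shortest E A z"
    unfolding shortest_def using raag_eq_words[OF z(1)] by (blast intro: raag_eq_trans)
  with z(1) show ?thesis by (rule that)
qed

text \<open>
  A word is pinch-free at v if it has no subword that consists of a letter of v, letters that
  multiply to an element of the subgroup generated by the vertices commuting with v, and the
  inverse letter of v. This is reducedness for the HNN extension with stable letter v.
\<close>

definition pinch_free :: "('a \<times> 'a) set \<Rightarrow> 'a set \<Rightarrow> 'a \<Rightarrow> 'a word \<Rightarrow> bool" where
  "pinch_free E A v w \<longleftrightarrow>
     \<not> (\<exists>a e x b y. w = a @ [(v, e)] @ x @ [(v, \<not> e)] @ b \<and>
          (x, y) \<in> raag_eq E (A - {v}) \<and> y \<in> words {u. (v, u) \<notin> E})"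

lemma pinch_freeD:
  assumes "pinch_free E A v w" "w = a @ [(v, e)] @ x @ [(v, \<not> e)] @ b" "(x, y) \<in> raag_eq E (A - {v})"
  obtains u where "u \<in> fst ` set y" "(v, u) \<in> E"
  using assms unfolding pinch_free_def words_iff by blast

text \<open>
  If x lies in the subgroup generated by the vertices commuting with v, then killing the other
  generators in x does not change the element and does not lengthen the word. The two letters of
  the pinch then cancel.
\<close>

lemma shortest_imp_pinch_free:
  assumes "shortest E A w"
  shows "pinch_free E A v w"
  unfolding pinch_free_def
proof (safe)
  fix a e x b y
  assume w: "w = a @ [(v, e)] @ x @ [(v, \<not> e)] @ b"
    and xy: "(x, y) \<in> raag_eq E (A - {v})" and y: "y \<in> words {u. (v, u) \<notin> E}"
  let ?B = "{u \<in> A - {v}. (v, u) \<notin> E}" and ?x = "restrict_word {u \<in> A - {v}. (v, u) \<notin> E} x"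
  have words: "a \<in> words A" "b \<in> words A" "v \<in> A" "x \<in> words A" "x \<in> words (A - {v})"
      "y \<in> words (A - {v})"
    using assms raag_eq_words[OF xy] by (auto simp: shortest_def w)
  have x_words: "?x \<in> words ?B" "?x \<in> words A"
    using restrict_word_words[OF words(4)] by (auto simp: words_iff)
  have "y \<in> words ?B"
    using y words by (auto simp: words_iff)
  then have "(?x, y) \<in> raag_eq E (A - {v})"
    using raag_eq_mono[OF raag_eq_restrict[OF xy, of ?B], of "A - {v}"] restrict_word_id[of y ?B]
    by auto
  then have "(x, ?x) \<in> raag_eq E (A - {v})"
    using xy by (blast intro: raag_eq_trans raag_eq_sym)
  then have "(x, ?x) \<in> raag_eq E A"
    by (rule raag_eq_mono) auto
  then have "(a @ [(v, e)] @ x @ [(v, \<not> e)] @ b, a @ [(v, e)] @ ?x @ [(v, \<not> e)] @ b) \<in> raag_eq E A"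
    using raag_eq_context[of x ?x E A "a @ [(v, e)]" "[(v, \<not> e)] @ b"] words by simp
  also have "([(v, e)] @ ?x, ?x @ [(v, e)]) \<in> raag_eq E A"
    using x_words by (intro raag_eq_commute_words) (auto simp: words(3))
  then have "(a @ [(v, e)] @ ?x @ [(v, \<not> e)] @ b, a @ ?x @ [(v, e), (v, \<not> e)] @ b) \<in> raag_eq E A"
    using raag_eq_context[of "[(v, e)] @ ?x" "?x @ [(v, e)]" E A a "[(v, \<not> e)] @ b"] words by simp
  also have "(a @ ?x @ [(v, e), (v, \<not> e)] @ b, a @ ?x @ b) \<in> raag_eq E A"
    using pres_rel.cancel[of "a @ ?x" A b v e] words x_words(2) by (simp add: raag_eq_def)
  finally have "length w \<le> length (a @ ?x @ b)"
    using assms unfolding shortest_def w by blast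
  moreover have "length ?x \<le> length x" by simp
  ultimately show False
    by (simp only: w length_append list.size)
qed

section \<open>Counting stable letters in an HNN extension\<close>

text \<open>
  The HNN extension of a group K along the identity of a subgroup H, that is, with a stable letter
  t that commutes with H. A pair of k and \<open>[(e\<^sub>1, c\<^sub>1), \<dots>, (e\<^sub>n, c\<^sub>n)]\<close> stands for the element
  \<open>k t\<^sup>e\<^sup>1 c\<^sub>1 \<dots> t\<^sup>e\<^sup>n c\<^sub>n\<close>, with \<open>True\<close> and \<open>False\<close> for the exponents 1 and -1. Letting K and t act on
  normal forms by left multiplication avoids constructing the extension.
\<close>

locale hnn_trivial = group K for K (structure) +
  fixes H
  assumes subgroup_H: "subgroup H K"
begin

text \<open>A representative of the right coset of H, chosen to be the unit for H itself.\<close>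

definition rep :: "'a \<Rightarrow> 'a" where
  "rep k = (if k \<in> H then \<one> else SOME c. c \<in> H #> k)"

text \<open>Left multiplication of a normal form by the stable letter or its inverse.\<close>

fun stable :: "bool \<Rightarrow> 'a \<times> (bool \<times> 'a) list \<Rightarrow> 'a \<times> (bool \<times> 'a) list" where
  "stable e (k, l) =
     (if k \<in> H \<and> l \<noteq> [] \<and> fst (hd l) = (\<not> e) then (k \<otimes> snd (hd l), tl l)
      else (k \<otimes> inv (rep k), (e, rep k) # l))"

text \<open>
  All entries of the list are coset representatives, and no two consecutive opposite stable letters
  are separated by an element of H.
\<close>

definition normal_forms :: "('a \<times> (bool \<times> 'a) list) set" where
  "normal_forms = {(k, l). k \<in> carrier K \<and> (\<forall>(e, c)\<in>set l. c \<in> carrier K \<and> rep c = c) \<and>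
     successively (\<lambda>(e, c) (e', c'). c \<in> H \<longrightarrow> e = e') l}"

lemma H_carrier: "h \<in> H \<Longrightarrow> h \<in> carrier K"
  using subgroup_H by (rule subgroup.mem_carrier)

lemma H_mult_iff: "h \<in> H \<Longrightarrow> k \<in> carrier K \<Longrightarrow> h \<otimes> k \<in> H \<longleftrightarrow> k \<in> H"
  using subgroup_H
  by (metis H_carrier inv_solve_left subgroup.m_closed subgroup.m_inv_closed)

lemma rep_H [simp]: "k \<in> H \<Longrightarrow> rep k = \<one>"
  by (simp add: rep_def)

lemma rep_in_coset: "k \<in> carrier K \<Longrightarrow> rep k \<in> H #> k"
  unfolding rep_def
  using rcos_self[OF _ subgroup_H] coset_join2[OF _ subgroup_H] subgroup.one_closed[OF subgroup_H]
  by (auto intro: someI[of "\<lambda>c. c \<in> H #> k" k])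

lemma rep_carrier: "k \<in> carrier K \<Longrightarrow> rep k \<in> carrier K"
  using rep_in_coset r_coset_subset_G subgroup.subset[OF subgroup_H] by blast

lemma rep_quotient: "k \<in> carrier K \<Longrightarrow> k \<otimes> inv (rep k) \<in> H"
proof -
  assume k: "k \<in> carrier K"
  then obtain h where h: "h \<in> H" "rep k = h \<otimes> k"
    using rep_in_coset by (auto simp: r_coset_def)
  then have "k \<otimes> inv (rep k) = inv h"
    using k H_carrier by (simp add: inv_mult_group m_assoc[symmetric])
  then show ?thesis
    using h subgroup.m_inv_closed[OF subgroup_H] by simp
qed

lemma rep_split: "k \<in> carrier K \<Longrightarrow> k \<otimes> inv (rep k) \<otimes> rep k = k"
  by (simp add: m_assoc rep_carrier)

lemma rep_mult: "h \<in> H \<Longrightarrow> k \<in> carrier K \<Longrightarrow> rep (h \<otimes> k) = rep k"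
  unfolding rep_def using H_mult_iff
  by (metis H_carrier coset_join2 coset_mult_assoc subgroup.subset subgroup_H)

lemma rep_rep: "k \<in> carrier K \<Longrightarrow> rep (rep k) = rep k"
  using rep_mult[OF rep_quotient rep_carrier] rep_split by metis

lemma rep_in_H_iff: "k \<in> carrier K \<Longrightarrow> rep k \<in> H \<longleftrightarrow> k \<in> H"
  using H_mult_iff[OF rep_quotient rep_carrier] rep_split by metis

lemma stable_normal_forms:
  assumes "\<sigma> \<in> normal_forms"
  shows "stable e \<sigma> \<in> normal_forms"
proof -
  obtain k l where \<sigma>: "\<sigma> = (k, l)" by fastforce
  with assms show ?thesis
    by (cases l)
      (auto simp: normal_forms_def rep_carrier rep_rep rep_in_H_iff successively_Cons H_carrier)
qed

lemma stable_inverse: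
  assumes "\<sigma> \<in> normal_forms"
  shows "stable (\<not> e) (stable e \<sigma>) = \<sigma>"
proof -
  obtain k l where \<sigma>: "\<sigma> = (k, l)" by fastforce
  have k: "k \<in> carrier K" using assms by (simp add: \<sigma> normal_forms_def)
  show ?thesis
  proof (cases "k \<in> H \<and> l \<noteq> [] \<and> fst (hd l) = (\<not> e)")
    case True
    then obtain c l' where l: "l = (\<not> e, c) # l'"
      by (cases l) auto
    have c: "c \<in> carrier K" "rep c = c" "c \<in> H \<Longrightarrow> l' \<noteq> [] \<Longrightarrow> fst (hd l') = (\<not> e)"
      using assms by (auto simp: \<sigma> normal_forms_def l successively_Cons)
    have "rep (k \<otimes> c) = c" "k \<otimes> c \<in> H \<longleftrightarrow> c \<in> H" "k \<otimes> c \<otimes> inv c = k"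
      using True c k by (auto simp: rep_mult H_mult_iff m_assoc)
    with True c show ?thesis by (auto simp: \<sigma> l)
  next
    case False
    then show ?thesis
      using k by (auto simp: \<sigma> rep_quotient rep_split)
  qed
qed

lemma stable_mult:
  assumes "(k, l) \<in> normal_forms" "h \<in> H"
  shows "stable e (h \<otimes> k, l) = (h \<otimes> fst (stable e (k, l)), snd (stable e (k, l)))"
  using assms
  by (cases l)
    (auto simp: normal_forms_def H_mult_iff rep_mult m_assoc H_carrier rep_carrier)

lemma length_stable: "length (snd (stable e \<sigma>)) \<le> Suc (length (snd \<sigma>))"
  by (cases \<sigma>) auto

end

abbreviation occurrences :: "'a \<Rightarrow> 'a word \<Rightarrow> nat" where
  "occurrences v w \<equiv> length (filter (\<lambda>x. fst x = v) w)"

lemma pinch_free_tl: "pinch_free E A v (x # w) \<Longrightarrow> pinch_free E A v w"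
  unfolding pinch_free_def by (metis append_Cons)

text \<open>
  Britton's lemma in quantitative form. Letters of v act on normal forms as the stable letter, all
  other letters by multiplication in K. The action respects equality in the group. The list
  in the image of the trivial normal form has at most as many entries as the word has
  letters of v, with equality for pinch-free words.
\<close>

lemma pinch_free_minimal:
  assumes "sym E"
    and w: "w \<in> words A" "pinch_free E A v w" and wz: "(w, z) \<in> raag_eq E A"
  shows "occurrences v w \<le> occurrences v z"
proof -
  let ?A = "A - {v}"
  define R where "R = {commutator_word u v | u v. u \<in> ?A \<and> v \<in> ?A \<and> u \<noteq> v \<and> (u, v) \<notin> E}"
  define K where "K = presented_group ?A R"
  define cls where "cls = (\<lambda>w. pres_rel ?A R `` {w})"
  define H where "H = cls ` words {u \<in> ?A. (v, u) \<notin> E}"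
  interpret K: group K
    unfolding K_def by (rule group_presented_group)
  have mult: "cls a \<otimes>\<^bsub>K\<^esub> cls b = cls (a @ b)" if "a \<in> words ?A" "b \<in> words ?A" for a b
    using presented_group_mult[OF that] by (simp add: K_def cls_def)
  have one: "\<one>\<^bsub>K\<^esub> = cls []"
    by (simp add: K_def cls_def presented_group_def)
  have car: "carrier K = cls ` words ?A"
    by (auto simp: K_def cls_def presented_group_def quotient_def)
  have cls_eq: "cls a = cls b \<longleftrightarrow> (a, b) \<in> raag_eq E ?A" if "a \<in> words ?A" "b \<in> words ?A" for a b
    unfolding cls_def raag_eq_def R_def
    using eq_equiv_class_iff[OF equiv_pres_rel that] by blast
  have H_words: "a \<in> words ?A" if "a \<in> words {u \<in> ?A. (v, u) \<notin> E}" for a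
    using that by (auto simp: words_iff)
  have "subgroup H K"
  proof (rule K.subgroupI)
    show "H \<subseteq> carrier K"
      using H_words by (auto simp: H_def car)
    show "H \<noteq> {}"
      unfolding H_def using words_Nil by blast
    show "a \<otimes>\<^bsub>K\<^esub> b \<in> H" if "a \<in> H" "b \<in> H" for a b
      using that H_words by (auto simp: H_def mult)
    show "inv\<^bsub>K\<^esub> a \<in> H" if a: "a \<in> H" for a
    proof -
      obtain u where u: "u \<in> words {u \<in> ?A. (v, u) \<notin> E}" "a = cls u"
        using a unfolding H_def by blast
      have "cls (inv_word u) \<otimes>\<^bsub>K\<^esub> cls u = \<one>\<^bsub>K\<^esub>"
        using pres_rel_inv_word[OF H_words[OF u(1)], of R] H_words[OF u(1)]
        by (simp add: mult inv_word_words one) (simp add: cls_def equiv_class_eq[OF equiv_pres_rel])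
      then have "inv\<^bsub>K\<^esub> a = cls (inv_word u)"
        unfolding u(2) by (rule K.inv_equality) (use H_words[OF u(1)] in \<open>auto simp: car inv_word_words\<close>)
      then show ?thesis
        using u(1) by (auto simp: H_def inv_word_words)
    qed
  qed
  then interpret hnn_trivial K H
    by (simp add: hnn_trivial_def hnn_trivial_axioms_def K.is_group)
  define act where "act = (\<lambda>x \<sigma>. if fst x = v then stable (snd x) \<sigma>
     else (cls [x] \<otimes>\<^bsub>K\<^esub> fst \<sigma>, snd \<sigma>))"
  have cls_letter: "cls [x] \<in> carrier K" if "fst x \<in> A" "fst x \<noteq> v" for x
    using that by (auto simp: car)
  have act_normal: "act x \<sigma> \<in> normal_forms" if "fst x \<in> A" "\<sigma> \<in> normal_forms" for x \<sigma>
  proof (cases "fst x = v")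
    case True
    with that show ?thesis by (simp add: act_def stable_normal_forms)
  next
    case False
    with that cls_letter[of x] show ?thesis by (cases \<sigma>) (simp add: act_def normal_forms_def)
  qed
  have act_word_normal: "foldr act u \<sigma> \<in> normal_forms" if "u \<in> words A" "\<sigma> \<in> normal_forms" for u \<sigma>
    using that by (induction u) (auto intro: act_normal)
  have act_inverse: "act (s, b) (act (s, \<not> b) \<sigma>) = \<sigma>" if "s \<in> A" "\<sigma> \<in> normal_forms" for s b \<sigma>
  proof (cases "s = v")
    case True
    with stable_inverse[of \<sigma> "\<not> b"] that show ?thesis by (simp add: act_def)
  next
    case False
    with that have "cls [(s, b)] \<otimes>\<^bsub>K\<^esub> cls [(s, \<not> b)] = \<one>\<^bsub>K\<^esub>"
      using pres_rel_cancel2[of s ?A b R]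
      by (simp add: mult one) (simp add: cls_def equiv_class_eq[OF equiv_pres_rel])
    with False that cls_letter show ?thesis
      by (auto simp: act_def normal_forms_def K.m_assoc[symmetric])
  qed
  have act_commute_v: "act (v, a) (act (y, b) \<sigma>) = act (y, b) (act (v, a) \<sigma>)"
    if "y \<in> A" "y \<noteq> v" "(v, y) \<notin> E" "\<sigma> \<in> normal_forms" for y a b \<sigma>
  proof -
    have "cls [(y, b)] \<in> H"
      using that unfolding H_def by (intro imageI) simp
    with that stable_mult[of "fst \<sigma>" "snd \<sigma>"] show ?thesis
      by (simp add: act_def)
  qed
  have act_commute: "act (x, a) (act (y, b) \<sigma>) = act (y, b) (act (x, a) \<sigma>)"
    if "x \<in> A" "y \<in> A" "x \<noteq> y" "(x, y) \<notin> E" "\<sigma> \<in> normal_forms" for x y a b \<sigma>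
  proof -
    consider "x = v" | "y = v" | "x \<noteq> v" "y \<noteq> v" by blast
    then show ?thesis
    proof cases
      case 1
      with that show ?thesis by (simp add: act_commute_v)
    next
      case 2
      with that \<open>sym E\<close> show ?thesis by (metis act_commute_v symD)
    next
      case 3
      have "([(x, a), (y, b)], [(y, b), (x, a)]) \<in> pres_rel ?A R"
        by (rule pres_rel_commute_letters) (use that 3 in \<open>auto simp: R_def\<close>)
      then have "cls [(x, a)] \<otimes>\<^bsub>K\<^esub> cls [(y, b)] = cls [(y, b)] \<otimes>\<^bsub>K\<^esub> cls [(x, a)]"
        using that 3 by (simp add: mult) (simp add: cls_def equiv_class_eq[OF equiv_pres_rel])
      with that 3 cls_letter show ?thesis
        by (auto simp: act_def normal_forms_def K.m_assoc[symmetric])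
    qed
  qed
  have invariant: "foldr act u \<sigma> = foldr act u' \<sigma>"
    if "(u, u') \<in> raag_eq E A" "\<sigma> \<in> normal_forms" for u u' \<sigma>
    using that unfolding raag_eq_def
  proof (induction arbitrary: \<sigma> rule: pres_rel.induct)
    case (cancel u v s b)
    then show ?case by (simp add: act_inverse act_word_normal)
  next
    case (relator u v r)
    then obtain x y where r: "r = commutator_word x y" "x \<in> A" "y \<in> A" "x \<noteq> y" "(x, y) \<notin> E"
      by blast
    have "foldr act r \<tau> = \<tau>" if "\<tau> \<in> normal_forms" for \<tau>
    proof -
      have "act (y, True) (act (x, False) (act (y, False) \<tau>)) =
          act (x, False) (act (y, True) (act (y, False) \<tau>))"
        using r that by (intro act_commute[symmetric] act_normal) auto
      then show ?thesis
        using act_inverse[of y \<tau> True] act_inverse[of x \<tau> True] r that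
        by (simp add: commutator_word_def)
    qed
    with relator show ?case by (simp add: act_word_normal)
  qed auto
  let ?o = "(\<one>\<^bsub>K\<^esub>, []) :: 'a word set \<times> (bool \<times> 'a word set) list"
  have o: "?o \<in> normal_forms"
    by (simp add: normal_forms_def)
  have upper: "length (snd (foldr act u ?o)) \<le> occurrences v u" for u
  proof (induction u)
    case (Cons x u)
    then show ?case
      using length_stable[of "snd x" "foldr act u ?o"] by (auto simp: act_def)
  qed simp
  \<comment> \<open>For the induction, the first component must be known modulo H: it is the part of the word
    before the first letter of v.\<close>
  have lower: "length (snd (foldr act u ?o)) = occurrences v u \<and>
      (\<exists>h\<in>H. fst (foldr act u ?o) = cls (takeWhile (\<lambda>x. fst x \<noteq> v) u) \<otimes>\<^bsub>K\<^esub> h) \<and>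
      (\<forall>y b. dropWhile (\<lambda>x. fst x \<noteq> v) u = y # b \<longrightarrow>
         snd (foldr act u ?o) \<noteq> [] \<and> fst (hd (snd (foldr act u ?o))) = snd y)"
    if "u \<in> words A" "pinch_free E A v u" for u
    using that
  proof (induction u)
    case Nil
    have "\<one>\<^bsub>K\<^esub> \<in> H" by (rule subgroup.one_closed[OF subgroup_H])
    then show ?case
      by (auto simp: one[symmetric] intro: bexI[of _ "\<one>\<^bsub>K\<^esub>"])
  next
    case (Cons p u)
    obtain k l where kl: "foldr act u ?o = (k, l)" by fastforce
    define x where "x = takeWhile (\<lambda>x. fst x \<noteq> v) u"
    have u: "u \<in> words A" "pinch_free E A v u"
      using Cons.prems pinch_free_tl[of E A v p u] by auto
    have x_words: "x \<in> words ?A"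
      using u(1) by (auto simp: words_iff x_def dest: set_takeWhileD)
    obtain h where h: "h \<in> H" "k = cls x \<otimes>\<^bsub>K\<^esub> h"
      using Cons.IH[OF u] by (auto simp: kl x_def)
    have len: "length l = occurrences v u"
      using Cons.IH[OF u] by (simp add: kl)
    have k: "k \<in> carrier K"
      using act_word_normal[OF u(1) o] by (auto simp: kl normal_forms_def)
    show ?case
    proof (cases "fst p = v")
      case False
      have 1: "cls [p] \<otimes>\<^bsub>K\<^esub> (cls x \<otimes>\<^bsub>K\<^esub> h) = cls (p # x) \<otimes>\<^bsub>K\<^esub> h"
        using mult[of "[p]" x] False Cons.prems(1) x_words h(1)
          K.m_assoc[of "cls [p]" "cls x" h] H_carrier[of h] by (auto simp: car)
      have "act p (k, l) = (cls (p # x) \<otimes>\<^bsub>K\<^esub> h, l)"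
        using False by (simp add: act_def h(2) 1)
      then have "foldr act (p # u) ?o = (cls (p # x) \<otimes>\<^bsub>K\<^esub> h, l)"
        by (simp add: kl)
      with False h(1) Cons.IH[OF u] show ?thesis
        by (auto simp: kl x_def)
    next
      case True
      obtain e where p: "p = (v, e)" using True by (cases p) auto
      have "\<not> (k \<in> H \<and> l \<noteq> [] \<and> fst (hd l) = (\<not> e))"
      proof
        assume *: "k \<in> H \<and> l \<noteq> [] \<and> fst (hd l) = (\<not> e)"
        then have "occurrences v u \<noteq> 0"
          by (simp flip: len)
        then have "dropWhile (\<lambda>x. fst x \<noteq> v) u \<noteq> []"
          by (auto simp: filter_empty_conv)
        then obtain y b where yb: "dropWhile (\<lambda>x. fst x \<noteq> v) u = y # b"
          by (cases "dropWhile (\<lambda>x. fst x \<noteq> v) u") auto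
        have "y = (v, \<not> e)"
          using Cons.IH[OF u] * yb hd_dropWhile[of "\<lambda>x. fst x \<noteq> v" u]
          by (cases y) (auto simp: kl)
        then have "p # u = [] @ [(v, e)] @ x @ [(v, \<not> e)] @ b"
          using yb takeWhile_dropWhile_id[of "\<lambda>x. fst x \<noteq> v" u] by (simp add: p x_def)
        moreover have "cls x \<in> carrier K"
          using x_words by (simp add: car)
        then have "cls x = k \<otimes>\<^bsub>K\<^esub> inv\<^bsub>K\<^esub> h"
          using H_carrier[OF h(1)] by (simp add: h(2) K.m_assoc)
        then have "cls x \<in> H"
          using * h(1) subgroup_H by (simp add: subgroup.m_closed subgroup.m_inv_closed)
        then obtain y where y: "y \<in> words {u \<in> ?A. (v, u) \<notin> E}" "cls x = cls y"
          unfolding H_def by blast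
        then have "(x, y) \<in> raag_eq E ?A"
          using cls_eq[OF x_words H_words[OF y(1)]] by simp
        moreover have "y \<in> words {u. (v, u) \<notin> E}"
          using y(1) by (auto simp: words_iff)
        ultimately show False
          using Cons.prems(2) unfolding pinch_free_def by blast
      qed
      then have "act p (k, l) = (k \<otimes>\<^bsub>K\<^esub> inv\<^bsub>K\<^esub> (rep k), (e, rep k) # l)"
        by (auto simp: act_def p)
      then show ?thesis
        using len rep_quotient[OF k] H_carrier
        by (auto simp: kl p one[symmetric])
    qed
  qed
  have "occurrences v w = length (snd (foldr act w ?o))"
    using lower[OF w] by simp
  also have "\<dots> = length (snd (foldr act z ?o))"
    using invariant[OF wz o] by simp
  also have "\<dots> \<le> occurrences v z"
    by (rule upper)
  finally show ?thesis .
qed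

section \<open>Lifting words along an unfolding\<close>

text \<open>
  A finite graph with edge relation E', whose vertices are labelled by those of a graph with edge
  relation E such that edges go to edges. Edge relations are symmetric, and E has no loops. The
  vertices are enumerated by a list in order to fix the order of the factors in products of vertices.
\<close>

locale labelled_graph =
  fixes E :: "('a \<times> 'a) set" and E' :: "('b \<times> 'b) set"
    and lab :: "'b \<Rightarrow> 'a" and vs :: "'b list"
  assumes sym_E: "sym E" and irrefl_E: "irrefl E" and sym_E': "sym E'"
    and distinct_vs: "distinct vs"
    and lab_edge: "x \<in> set vs \<Longrightarrow> y \<in> set vs \<Longrightarrow> (x, y) \<in> E' \<Longrightarrow> (lab x, lab y) \<in> E"
begin

text \<open>A letter is sent to the product of all vertices in D with that label.\<close>

definition lift :: "'b set \<Rightarrow> 'a \<times> bool \<Rightarrow> 'b word" where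
  "lift D x = map (\<lambda>y. (y, snd x)) (filter (\<lambda>y. y \<in> D \<and> lab y = fst x) vs)"

abbreviation lift_word :: "'b set \<Rightarrow> 'a word \<Rightarrow> 'b word" where
  "lift_word D w \<equiv> concat (map (lift D) w)"

lemma set_lift: "p \<in> set (lift D x) \<longleftrightarrow> fst p \<in> D \<inter> set vs \<and> lab (fst p) = fst x \<and> snd p = snd x"
  by (cases p) (auto simp: lift_def)

lemma set_lift_word:
  "p \<in> set (lift_word D w) \<longleftrightarrow> fst p \<in> D \<inter> set vs \<and> (lab (fst p), snd p) \<in> set w"
  by (auto simp: set_lift) (metis fst_conv snd_conv)

lemma lift_word_words: "lift_word D w \<in> words D"
  by (auto simp: words_iff set_lift)

lemma restrict_lift_word: "B \<subseteq> D \<Longrightarrow> restrict_word B (lift_word D w) = lift_word B w"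
proof (induction w)
  case (Cons x w)
  have "filter (\<lambda>y. fst y \<in> B) (lift D x) = lift B x"
    using Cons.prems by (auto simp: lift_def filter_map o_def intro!: arg_cong[where f = "map _"] filter_cong)
  with Cons show ?case by simp
qed simp

lemma lift_commute:
  assumes D: "D \<subseteq> set vs" and "(fst x, fst y) \<notin> E"
  shows "(lift D x @ lift D y, lift D y @ lift D x) \<in> raag_eq E' D"
proof (rule raag_eq_commute_words)
  fix a b assume "a \<in> fst ` set (lift D x)" "b \<in> fst ` set (lift D y)"
  then show "(a, b) \<notin> E'"
    using lab_edge[of a b] D assms(2) by (auto simp: set_lift)
qed (auto simp: words_iff set_lift)

lemma lift_inverse:
  assumes D: "D \<subseteq> set vs"
  shows "(lift D (s, b) @ lift D (s, \<not> b), []) \<in> raag_eq E' D"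
proof -
  have inverse: "(map (\<lambda>y. (y, b)) ys @ map (\<lambda>y. (y, \<not> b)) ys, []) \<in> raag_eq E' D"
    if "set ys \<subseteq> D" "\<And>x y. x \<in> set ys \<Longrightarrow> y \<in> set ys \<Longrightarrow> (x, y) \<notin> E'" for ys
    using that
  proof (induction ys)
    case Nil
    then show ?case by (simp add: raag_eq_refl)
  next
    case (Cons y ys)
    let ?p = "map (\<lambda>y. (y, b)) ys" and ?q = "map (\<lambda>y. (y, \<not> b)) ys"
    have w: "?p \<in> words D" "?q \<in> words D" "y \<in> D"
      using Cons.prems(1) by (auto simp: words_iff)
    have "(?p @ [(y, \<not> b)], [(y, \<not> b)] @ ?p) \<in> raag_eq E' D"
      using w Cons.prems(2) by (intro raag_eq_commute_words) auto
    then have "([(y, b)] @ (?p @ [(y, \<not> b)]) @ ?q, [(y, b)] @ ([(y, \<not> b)] @ ?p) @ ?q) \<in> raag_eq E' D"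
      by (rule raag_eq_context) (use w in auto)
    also have "([] @ [(y, b), (y, \<not> b)] @ (?p @ ?q), [] @ (?p @ ?q)) \<in> raag_eq E' D"
      unfolding raag_eq_def by (rule pres_rel.cancel) (use w in auto)
    then have "([(y, b)] @ ([(y, \<not> b)] @ ?p) @ ?q, ?p @ ?q) \<in> raag_eq E' D"
      by simp
    also have "(?p @ ?q, []) \<in> raag_eq E' D"
      using Cons by auto
    finally show ?case by simp
  qed
  show ?thesis
    unfolding lift_def fst_conv snd_conv
  proof (rule inverse)
    fix x y
    assume "x \<in> set (filter (\<lambda>y. y \<in> D \<and> lab y = s) vs)"
      "y \<in> set (filter (\<lambda>y. y \<in> D \<and> lab y = s) vs)"
    then have "x \<in> set vs" "y \<in> set vs" "lab x = lab y" by auto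
    with lab_edge[of x y] irrefl_E show "(x, y) \<notin> E'"
      unfolding irrefl_def by metis
  qed auto
qed

lemma lift_eq:
  assumes "(v, w) \<in> raag_eq E A" and D: "D \<subseteq> set vs"
  shows "(lift_word D v, lift_word D w) \<in> raag_eq E' D"
  unfolding raag_eq_def
proof (rule pres_rel_subst[OF assms(1)[unfolded raag_eq_def]], fold raag_eq_def)
  show "lift D x \<in> words D" for x
    by (auto simp: words_iff set_lift)
  show "(lift D (s, b) @ lift D (s, \<not> b), []) \<in> raag_eq E' D" for s b
    by (rule lift_inverse[OF D])
  fix r assume "r \<in> {commutator_word u v |u v. u \<in> A \<and> v \<in> A \<and> u \<noteq> v \<and> (u, v) \<notin> E}"
  then obtain x y where r: "r = commutator_word x y" "(x, y) \<notin> E" by blast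
  let ?X = "lift D (x, True)" and ?Y = "lift D (y, True)"
    and ?x = "lift D (x, False)" and ?y = "lift D (y, False)"
  have w: "?X \<in> words D" "?Y \<in> words D" "?x \<in> words D" "?y \<in> words D"
    by (auto simp: words_iff set_lift)
  have "(?X @ (?Y @ ?x) @ ?y, ?X @ (?x @ ?Y) @ ?y) \<in> raag_eq E' D"
    using r(2) sym_E w by (intro raag_eq_context lift_commute[OF D]) (auto dest: symD)
  also have "([] @ (?X @ ?x) @ (?Y @ ?y), [] @ [] @ (?Y @ ?y)) \<in> raag_eq E' D"
    by (rule raag_eq_context) (use w lift_inverse[OF D, of x True] in auto)
  then have "(?X @ (?x @ ?Y) @ ?y, ?Y @ ?y) \<in> raag_eq E' D"
    by simp
  also have "(?Y @ ?y, []) \<in> raag_eq E' D"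
    using lift_inverse[OF D, of y True] by simp
  finally show "(concat (map (lift D) r), []) \<in> raag_eq E' D"
    by (simp add: r(1) commutator_word_def)
qed

lemma lift_single:
  assumes D: "D \<subseteq> set vs" and t: "{x \<in> D. lab x = v} = {t}"
  shows "lift D (v, b) = [(t, b)]"
proof -
  have singleton: "ys = [t]" if "distinct ys" "set ys = {t}" for ys
    using that by (cases ys; cases "tl ys") auto
  have "filter (\<lambda>y. y \<in> D \<and> lab y = v) vs = [t]"
    by (rule singleton) (use D t distinct_vs in auto)
  then show ?thesis by (simp add: lift_def)
qed

lemma lift_word_split:
  assumes D: "D \<subseteq> set vs" and t: "{x \<in> D. lab x = v} = {t}"
    and "lift_word D w = a' @ (t, e) # r'"
  obtains a r where "w = a @ (v, e) # r" "lift_word D a = a'" "lift_word D r = r'"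
proof -
  have "\<exists>a r. w = a @ (v, e) # r \<and> lift_word D a = a' \<and> lift_word D r = r'"
    using assms(3)
  proof (induction w arbitrary: a')
    case (Cons x w)
    show ?case
    proof (cases "(t, e) \<in> set (lift D x)")
      case True
      then have x: "x = (v, e)"
        using t by (cases x) (auto simp: set_lift)
      then have lx: "lift D x = [(t, e)]"
        using lift_single[OF D t] by simp
      show ?thesis
      proof (cases a')
        case Nil
        with Cons.prems lx x show ?thesis by (intro exI[of _ "[]"] exI[of _ w]) simp
      next
        case (Cons p a'')
        with Cons.prems lx have "p = (t, e)" "lift_word D w = a'' @ (t, e) # r'" by auto
        with Cons.IH[of a''] obtain a r where
          "w = a @ (v, e) # r" "lift_word D a = a''" "lift_word D r = r'" by blast
        with lx Cons \<open>p = (t, e)\<close> show ?thesis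
          by (intro exI[of _ "x # a"] exI[of _ r]) simp
      qed
    next
      case False
      have eq: "lift D x @ lift_word D w = a' @ (t, e) # r'"
        using Cons.prems by simp
      then obtain us where us: "lift D x @ us = a' \<and> lift_word D w = us @ (t, e) # r' \<or>
          lift D x = a' @ us \<and> us @ lift_word D w = (t, e) # r'"
        by (auto simp: append_eq_append_conv2)
      with False have "a' = lift D x @ us \<and> lift_word D w = us @ (t, e) # r'"
        by (cases us) auto
      then have "a' = lift D x @ us" "lift_word D w = us @ (t, e) # r'" by auto
      with Cons.IH[of us] obtain a r where
        "w = a @ (v, e) # r" "lift_word D a = us" "lift_word D r = r'" by blast
      with \<open>a' = lift D x @ us\<close> show ?thesis
        by (intro exI[of _ "x # a"] exI[of _ r]) simp
    qed
  qed simp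
  then show ?thesis using that by blast
qed

text \<open>
  D contains an image, with root t, of the tree of simple paths that start at v and run in A: only
  the root has label v, and for each neighbour u of v the set D, with t removed, contains a
  neighbour of t that is the root of such a tree for u and \<open>A - {v}\<close>. The trees for different
  neighbours need not be disjoint, as only the existence of each of them matters below.
\<close>

inductive unfolds :: "'a set \<Rightarrow> 'a \<Rightarrow> 'b set \<Rightarrow> 'b \<Rightarrow> bool" where
  "{x \<in> D. lab x = v} = {t} \<Longrightarrow>
   (\<forall>u\<in>A - {v}. (v, u) \<in> E \<longrightarrow>
      (\<exists>D' t'. D' \<subseteq> D - {t} \<and> (t, t') \<in> E' \<and> unfolds (A - {v}) u D' t')) \<Longrightarrow>
   unfolds A v D t"

text \<open>
  In the lift of a pinch-free word, the letters of the root are not lost. The induction shows that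
  the lift is pinch-free at the root.
\<close>

lemma occurrences_le_unfolds:
  assumes "unfolds A v D t" "D \<subseteq> set vs" "w \<in> words A" "pinch_free E A v w"
    and "(lift_word D w, z) \<in> raag_eq E' D"
  shows "occurrences v w \<le> occurrences t z"
  using assms
proof (induction arbitrary: w z rule: unfolds.induct)
  case (1 D v t A)
  note t = \<open>{x \<in> D. lab x = v} = {t}\<close> and D = \<open>D \<subseteq> set vs\<close>
  have lt: "lab t = v" "t \<in> D" using t by auto
  have "occurrences t (lift_word D u) = occurrences v u" for u
  proof (induction u)
    case (Cons x u)
    have "filter (\<lambda>y. fst y = t) (lift D x) = (if fst x = v then [(t, snd x)] else [])"
    proof (cases "fst x = v")
      case True
      with lift_single[OF D t, of "snd x"] show ?thesis by (cases x) auto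
    next
      case False
      with lt show ?thesis by (auto simp: filter_empty_conv set_lift)
    qed
    with Cons show ?case by simp
  qed simp
  moreover have "pinch_free E' D t (lift_word D w)"
    unfolding pinch_free_def
  proof (safe)
    fix a' e x' b' y'
    assume split: "lift_word D w = a' @ [(t, e)] @ x' @ [(t, \<not> e)] @ b'"
      and xy': "(x', y') \<in> raag_eq E' (D - {t})" and y': "y' \<in> words {u. (t, u) \<notin> E'}"
    obtain a r where r: "w = a @ (v, e) # r" "lift_word D r = x' @ (t, \<not> e) # b'"
      using split by (auto intro: lift_word_split[OF D t, of w a' e "x' @ (t, \<not> e) # b'"])
    obtain x b where x: "r = x @ (v, \<not> e) # b" "lift_word D x = x'"
      using lift_word_split[OF D t r(2)] by metis
    have split_w: "w = a @ [(v, e)] @ x @ [(v, \<not> e)] @ b"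
      by (simp add: r(1) x(1))
    have "v \<notin> fst ` set x"
    proof
      assume "v \<in> fst ` set x"
      then obtain b where "(v, b) \<in> set x" by auto
      then have "(t, b) \<in> set x'"
        using lt D by (auto simp: x(2)[symmetric] set_lift_word simp del: set_concat)
      then show False
        using raag_eq_words[OF xy'] by (force simp: words_iff)
    qed
    then have "x \<in> words (A - {v})"
      using 1(4) by (auto simp: split_w words_iff)
    then obtain y where y: "(x, y) \<in> raag_eq E (A - {v})" "shortest E (A - {v}) y"
      by (rule ex_shortest)
    obtain u where u: "u \<in> fst ` set y" "(v, u) \<in> E"
      using pinch_freeD[OF 1(5) split_w y(1)] by blast
    have "u \<in> A - {v}"
      using u(1) raag_eq_words[OF y(1)] by (auto simp: words_iff)
    \<comment> \<open>The subtree for u still sees the letter u in a shortest word y for x.\<close>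
    then obtain D' t' where D': "D' \<subseteq> D - {t}" "(t, t') \<in> E'"
      and IH: "\<forall>w. D' \<subseteq> set vs \<longrightarrow> w \<in> words (A - {v}) \<longrightarrow> pinch_free E (A - {v}) u w \<longrightarrow>
          (\<forall>z. (lift_word D' w, z) \<in> raag_eq E' D' \<longrightarrow> occurrences u w \<le> occurrences t' z)"
      using bspec[OF 1(2), of u] u(2) by auto
    have "D' \<subseteq> D"
      using D'(1) by blast
    have "(lift_word D' y, lift_word D' x) \<in> raag_eq E' D'"
      by (rule lift_eq[OF raag_eq_sym[OF y(1)]]) (use D D' in auto)
    also have "(restrict_word D' x', restrict_word D' y') \<in> raag_eq E' D'"
      by (rule raag_eq_restrict[OF xy' D'(1)])
    then have "(lift_word D' x, restrict_word D' y') \<in> raag_eq E' D'"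
      using restrict_lift_word[of D' D x, unfolded x(2)] \<open>D' \<subseteq> D\<close> by simp
    finally have "occurrences u y \<le> occurrences t' (restrict_word D' y')"
      using D D' by (intro IH[rule_format] shortest_imp_pinch_free[OF y(2)]) (use y(2) in \<open>auto simp: shortest_def\<close>)
    moreover have "occurrences u y \<noteq> 0"
      using u(1) by (auto simp: filter_empty_conv)
    moreover have "occurrences t' (restrict_word D' y') = 0"
      using y' D'(2) by (auto simp: filter_empty_conv words_iff)
    ultimately show False by simp
  qed
  ultimately show ?case
    using pinch_free_minimal[where v = t, OF sym_E' lift_word_words _ 1(6)] by simp
qed

end

section \<open>The tree of simple paths\<close>

lemma pcas_consecutive:
  assumes "pcas u p v" "Suc i < length p"
  shows "snd (p ! i) = fst (p ! Suc i)"
  using assms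
proof (induction p arbitrary: u i)
  case (Cons e p)
  show ?case
  proof (cases i)
    case 0
    with Cons.prems show ?thesis by (cases p) auto
  next
    case (Suc j)
    with Cons.IH[of "snd e" j] Cons.prems show ?thesis by simp
  qed
qed simp

lemma pcas_ends: "pcas u p v \<Longrightarrow> p \<noteq> [] \<Longrightarrow> fst (hd p) = u \<and> snd (last p) = v"
  by (induction p arbitrary: u) auto

text \<open>
  A graph is a tree if every vertex except the root has a neighbour of smaller rank, its parent, and
  every edge joins a vertex to its parent.
\<close>

lemma finite_treeI:
  fixes rank :: "'a \<Rightarrow> nat"
  assumes T: "pair_graph T" and r: "r \<in> pverts T"
    and parent: "\<And>x. x \<in> pverts T \<Longrightarrow> x \<noteq> r \<Longrightarrow> (x, parent x) \<in> parcs T \<and> rank (parent x) < rank x"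
    and arc: "\<And>x y. (x, y) \<in> parcs T \<Longrightarrow> rank y \<le> rank x \<Longrightarrow> y = parent x"
  shows "finite_tree T"
  unfolding finite_tree_def
proof (intro conjI notI)
  interpret pair_graph T by fact
  show "pair_graph T" by fact
  have to_root: "x \<rightarrow>\<^sup>*\<^bsub>with_proj T\<^esub> r" if "x \<in> pverts T" for x
    using that
  proof (induction "rank x" arbitrary: x rule: less_induct)
    case less
    show ?case
    proof (cases "x = r")
      case True
      with less.prems show ?thesis by simp
    next
      case False
      with parent[OF less.prems] have p: "(x, parent x) \<in> parcs T" "rank (parent x) < rank x"
        by auto
      moreover have "parent x \<in> pverts T"
        using p(1) by (rule in_arcsD2)
      ultimately show ?thesis
        using less.hyps[of "parent x"] by (intro adj_reachable_trans[of x "parent x" r]) auto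
    qed
  qed
  have "x \<rightarrow>\<^sup>*\<^bsub>with_proj T\<^esub> y" if "x \<in> pverts T" "y \<in> pverts T" for x y
    using reachable_trans[OF to_root[OF that(1)] symmetric_reachable[OF sym_arcs to_root[OF that(2)]]] .
  then show "connected (with_proj T)"
    unfolding connected_def using r by (auto intro!: strongly_connectedI reachable_mk_symmetricI)
  assume "\<exists>p. pre_digraph.cycle (with_proj T) p \<and> 3 \<le> length p"
  then obtain p u where p: "set p \<subseteq> parcs T" "pcas u p u" "3 \<le> length p"
      "distinct (tl (pawalk_verts u p))"
    by (auto simp: cycle_def awalk_def)
  have ne: "p \<noteq> []"
    using p(3) by auto
  let ?n = "length p"
  define q where "q = map snd p"
  have verts: "pawalk_verts w p' = w # map snd p'" if "pcas w p' w'" for w p' w'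
    using that by (induction p' arbitrary: w) auto
  have q: "distinct q"
    using p(4) by (simp add: q_def verts[OF p(2)])
  have step: "(q ! i, q ! (if Suc i = ?n then 0 else Suc i)) \<in> parcs T" if "i < ?n" for i
  proof -
    let ?j = "if Suc i = ?n then 0 else Suc i"
    have j: "?j < ?n" using that by auto
    have "snd (p ! i) = fst (p ! ?j)"
    proof (cases "Suc i = ?n")
      case True
      then have "p ! i = last p"
        using last_conv_nth[OF ne] by (metis diff_Suc_1)
      then show ?thesis
        using pcas_ends[OF p(2) ne] True hd_conv_nth[OF ne] by simp
    next
      case False
      then show ?thesis using pcas_consecutive[OF p(2), of i] that by simp
    qed
    then have "(q ! i, q ! ?j) = p ! ?j"
      using that j by (simp add: q_def prod_eq_iff)
    then show ?thesis
      using p(1) j nth_mem[OF j] by auto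
  qed
  \<comment> \<open>Both neighbours of a vertex of maximal rank on the cycle are its parent.\<close>
  obtain i where i: "i < ?n" "\<And>j. j < ?n \<Longrightarrow> rank (q ! j) \<le> rank (q ! i)"
  proof -
    let ?R = "(\<lambda>j. rank (q ! j)) ` {..<?n}"
    have R: "finite ?R" "?R \<noteq> {}"
      using ne by (auto simp: lessThan_empty_iff)
    obtain i where i: "Max ?R = rank (q ! i)" "i \<in> {..<?n}"
      using Max_in[OF R] by (rule imageE)
    have "rank (q ! j) \<le> rank (q ! i)" if "j < ?n" for j
      unfolding i(1)[symmetric] by (rule Max_ge[OF R(1)]) (use that in simp)
    with i(2) show ?thesis
      by (intro that) auto
  qed
  define j where "j = (if Suc i = ?n then 0 else Suc i)"
  define k where "k = (if i = 0 then ?n - 1 else i - 1)"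
  have jk: "j < ?n" "k < ?n" "j \<noteq> k" "(if Suc k = ?n then 0 else Suc k) = i"
    using i(1) p(3) by (auto simp: j_def k_def)
  have "q ! j = parent (q ! i)"
    using step[OF i(1)] i(2)[OF jk(1)] by (intro arc) (auto simp: j_def)
  moreover have "(q ! i, q ! k) \<in> parcs T"
    using step[OF jk(2)] unfolding jk(4) by (rule arcs_symmetric)
  then have "q ! k = parent (q ! i)"
    using i(2)[OF jk(2)] by (rule arc)
  ultimately have "q ! j = q ! k" by simp
  moreover have "length q = ?n" by (simp add: q_def)
  ultimately show False
    using q jk by (simp add: nth_eq_iff_index_eq)
qed

text \<open>Vertex lists of simple paths in A, including the empty list.\<close>

definition simple_paths :: "('a \<times> 'a) set \<Rightarrow> 'a set \<Rightarrow> 'a list set" where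
  "simple_paths E A = {p. set p \<subseteq> A \<and> distinct p \<and> successively (\<lambda>x y. (x, y) \<in> E) p}"

lemma finite_simple_paths: "finite A \<Longrightarrow> finite (simple_paths E A)"
  unfolding simple_paths_def
  by (rule finite_subset[OF _ finite_subset_distinct[of A]]) auto

lemma simple_paths_butlast: "p @ [u] \<in> simple_paths E A \<Longrightarrow> p \<in> simple_paths E A"
  by (auto simp: simple_paths_def successively_append_iff)

lemma simple_paths_Cons:
  assumes "v \<in> A" "(v, u) \<in> E" "u # p \<in> simple_paths E (A - {v})"
  shows "v # u # p \<in> simple_paths E A"
  using assms by (auto simp: simple_paths_def)

text \<open>
  The tree of simple paths of \<open>\<Gamma>\<close>, with paths coded by natural numbers. The empty path
  only connects the trees of paths with different first vertices and has no label of its own, so it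
  is left out of the list of labelled vertices.
\<close>

lemma ex_tree_unfolding:
  fixes \<Gamma> :: "'a pair_pre_digraph"
  assumes "pair_graph \<Gamma>"
  obtains T :: "nat pair_pre_digraph" and lab vs D t where
    "finite_tree T" "labelled_graph (parcs \<Gamma>) (parcs T) lab vs" "set vs \<subseteq> pverts T"
    "\<And>v. v \<in> pverts \<Gamma> \<Longrightarrow> D v \<subseteq> set vs \<and> labelled_graph.unfolds (parcs \<Gamma>) (parcs T) lab (pverts \<Gamma>) v (D v) (t v)"
proof -
  interpret pair_graph \<Gamma> by fact
  let ?E = "parcs \<Gamma>" and ?A = "pverts \<Gamma>"
  define P where "P = simple_paths ?E ?A"
  have "finite P"
    unfolding P_def by (rule finite_simple_paths) (rule pair_finite_verts)
  then obtain code :: "'a list \<Rightarrow> nat" where code: "inj_on code P"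
    using finite_imp_inj_to_nat_seg by blast
  define path where "path = inv_into P code"
  have path: "path (code p) = p" if "p \<in> P" for p
    using that code by (simp add: path_def)
  have code_eq: "code p = code q \<longleftrightarrow> p = q" if "p \<in> P" "q \<in> P" for p q
    using that code by (auto dest: inj_onD)
  define E' where "E' = {(code p, code q) | p q. p \<in> P \<and> q \<in> P \<and> (\<exists>u. q = p @ [u] \<or> p = q @ [u])}"
  define T where "T = \<lparr>pverts = code ` P, parcs = E'\<rparr>"
  define lab where "lab = (\<lambda>n. last (path n))"
  define vs where "vs = sorted_list_of_set (code ` (P - {[]}))"
  have set_vs: "set vs = code ` (P - {[]})"
    using \<open>finite P\<close> by (simp add: vs_def)
  have T: "pair_graph T"
  proof
    show "finite (parcs T)"
      by (rule finite_subset[of _ "code ` P \<times> code ` P"]) (use \<open>finite P\<close> in \<open>auto simp: T_def E'_def\<close>)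
    show "symmetric (with_proj T)"
      unfolding symmetric_def by (rule symI) (auto simp: T_def E'_def)
  qed (use \<open>finite P\<close> in \<open>auto simp: T_def E'_def code_eq\<close>)
  have "finite_tree T"
  proof (rule finite_treeI[OF T, where r = "code []" and parent = "\<lambda>n. code (butlast (path n))"
        and rank = "\<lambda>n. length (path n)"])
    show "code [] \<in> pverts T"
      by (simp add: T_def P_def simple_paths_def)
  next
    fix x assume "x \<in> pverts T" "x \<noteq> code []"
    then obtain p u where p: "p @ [u] \<in> P" "x = code (p @ [u])"
      by (auto simp: T_def) (metis rev_exhaust)
    moreover have "p \<in> P"
      using p(1) unfolding P_def by (rule simple_paths_butlast)
    ultimately show "(x, code (butlast (path x))) \<in> parcs T \<and>
        length (path (code (butlast (path x)))) < length (path x)"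
      by (auto simp: T_def E'_def path)
  next
    fix x y assume "(x, y) \<in> parcs T" "length (path y) \<le> length (path x)"
    then show "y = code (butlast (path x))"
      by (auto simp: T_def E'_def path)
  qed
  moreover have lg: "labelled_graph ?E E' lab vs"
  proof
    show "sym ?E"
      using sym_arcs by (simp add: symmetric_def)
    show "irrefl ?E"
      using pair_no_loops[of "(x, x)" for x] by (auto simp: irrefl_def)
    show "sym E'"
      by (rule symI) (auto simp: E'_def)
    show "distinct vs"
      by (simp add: vs_def)
    fix x y assume xy: "x \<in> set vs" "y \<in> set vs" "(x, y) \<in> E'"
    then obtain p q u where pq: "x = code p" "y = code q" "p \<in> P" "q \<in> P" "q = p @ [u] \<or> p = q @ [u]"
      by (auto simp: E'_def)
    then have "p \<noteq> []" "q \<noteq> []"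
      using xy by (auto simp: set_vs code_eq)
    then show "(lab x, lab y) \<in> ?E"
      using pq by (auto simp: lab_def path P_def simple_paths_def successively_append_iff
          intro: arcs_symmetric)
  qed
  moreover have "set vs \<subseteq> pverts T"
    by (auto simp: set_vs T_def)
  moreover have "code ` {p \<in> P. p \<noteq> [] \<and> hd p = v} \<subseteq> set vs \<and>
      labelled_graph.unfolds ?E E' lab ?A v (code ` {p \<in> P. p \<noteq> [] \<and> hd p = v}) (code [v])"
    if v: "v \<in> ?A" for v
  proof
    interpret labelled_graph ?E E' lab vs by (rule lg)
    show "code ` {p \<in> P. p \<noteq> [] \<and> hd p = v} \<subseteq> set vs"
      by (auto simp: set_vs)
    \<comment> \<open>The prefix c is the part of the path already walked; its vertices are no longer in A.\<close>
    have "unfolds A v (code ` {c @ q | q. q \<in> simple_paths ?E A \<and> q \<noteq> [] \<and> hd q = v}) (code (c @ [v]))"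
      if "finite A" "v \<in> A" "\<And>q. q \<in> simple_paths ?E A \<Longrightarrow> q \<noteq> [] \<Longrightarrow> hd q = v \<Longrightarrow> c @ q \<in> P"
      for A v c
      using that
    proof (induction A arbitrary: v c rule: finite_psubset_induct)
      case (psubset A)
      let ?D = "\<lambda>A v c. code ` {c @ q | q. q \<in> simple_paths ?E A \<and> q \<noteq> [] \<and> hd q = v}"
      have sv: "[v] \<in> simple_paths ?E A"
        using psubset.prems(1) by (simp add: simple_paths_def)
      have cv: "c @ [v] \<in> P"
        using psubset.prems(2)[OF sv] by simp
      show ?case
      proof (rule unfolds.intros; (intro ballI impI)?)
        show "{x \<in> ?D A v c. lab x = v} = {code (c @ [v])}"
        proof (intro equalityI subsetI)
          fix x assume "x \<in> {x \<in> ?D A v c. lab x = v}"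
          then obtain q where q: "x = code (c @ q)" "q \<in> simple_paths ?E A" "q \<noteq> []" "hd q = v"
              "lab x = v"
            by auto
          then have "last q = v"
            using psubset.prems(2)[of q] by (simp add: lab_def path)
          with q have "q = [v]"
            by (cases q) (auto simp: simple_paths_def split: if_splits)
          with q show "x \<in> {code (c @ [v])}" by simp
        next
          fix x assume "x \<in> {code (c @ [v])}"
          then have x: "x = code (c @ [v])" by simp
          have "x \<in> ?D A v c"
            unfolding x by (intro imageI CollectI exI[of _ "[v]"]) (use sv in auto)
          then show "x \<in> {x \<in> ?D A v c. lab x = v}"
            using cv by (simp add: x lab_def path)
        qed
      next
        fix u assume u: "u \<in> A - {v}" "(v, u) \<in> ?E"
        let ?c = "c @ [v]"
        have ext: "v # q \<in> simple_paths ?E A"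
          if "q \<in> simple_paths ?E (A - {v})" "q \<noteq> []" "hd q = u" for q
          using simple_paths_Cons[OF psubset.prems(1) u(2), of "tl q"] that by (cases q) auto
        have ext_P: "?c @ q \<in> P"
          if "q \<in> simple_paths ?E (A - {v})" "q \<noteq> []" "hd q = u" for q
          using psubset.prems(2)[OF ext[OF that]] by simp
        have "[u] \<in> simple_paths ?E (A - {v})"
          using u(1) by (simp add: simple_paths_def)
        then have cvu: "?c @ [u] \<in> P"
          using ext_P[of "[u]"] by simp
        have "?D (A - {v}) u ?c \<subseteq> ?D A v c - {code ?c}"
        proof
          fix x assume "x \<in> ?D (A - {v}) u ?c"
          then obtain q where q: "x = code (?c @ q)" "q \<in> simple_paths ?E (A - {v})" "q \<noteq> []" "hd q = u"
            by auto
          have "x \<in> ?D A v c"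
            unfolding q(1) by (intro imageI CollectI exI[of _ "v # q"]) (use ext q in auto)
          moreover have "x \<noteq> code ?c"
            using code_eq[OF ext_P[OF q(2,3,4)] cv] q(1,3) by simp
          ultimately show "x \<in> ?D A v c - {code ?c}" by simp
        qed
        moreover have "(code ?c, code (?c @ [u])) \<in> E'"
          using cv cvu unfolding E'_def by blast
        moreover have "unfolds (A - {v}) u (?D (A - {v}) u ?c) (code (?c @ [u]))"
          using psubset.prems(1) u(1) ext_P by (intro psubset.IH) auto
        ultimately show "\<exists>D' t'. D' \<subseteq> ?D A v c - {code ?c} \<and> (code ?c, t') \<in> E' \<and>
            unfolds (A - {v}) u D' t'"
          by blast
      qed
    qed
    from this[of ?A v "[]"] v pair_finite_verts
    show "unfolds ?A v (code ` {p \<in> P. p \<noteq> [] \<and> hd p = v}) (code [v])"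
      by (simp add: P_def)
  qed
  ultimately show ?thesis
    by (intro that[of T lab vs "\<lambda>v. code ` {p \<in> P. p \<noteq> [] \<and> hd p = v}" "\<lambda>v. code [v]"])
      (simp_all add: T_def)
qed

section \<open>Word lengths in presented groups\<close>

context group
begin

lemma foldr_mult_closed: "set xs \<subseteq> carrier G \<Longrightarrow> foldr (\<otimes>) xs \<one> \<in> carrier G"
  by (induction xs) auto

lemma foldr_mult_append:
  "set xs \<subseteq> carrier G \<Longrightarrow> set ys \<subseteq> carrier G \<Longrightarrow>
     foldr (\<otimes>) (xs @ ys) \<one> = foldr (\<otimes>) xs \<one> \<otimes> foldr (\<otimes>) ys \<one>"
  by (induction xs) (auto simp: foldr_mult_closed m_assoc)

lemma word_length_le:
  "set xs \<subseteq> U \<union> m_inv G ` U \<Longrightarrow> word_length G U (foldr (\<otimes>) xs \<one>) \<le> length xs"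
  unfolding word_length_def by (rule Least_le) blast

lemma word_length_attained:
  assumes "U \<subseteq> carrier G" "g \<in> generate G U"
  obtains xs where "set xs \<subseteq> U \<union> m_inv G ` U" "length xs = word_length G U g" "foldr (\<otimes>) xs \<one> = g"
proof -
  let ?P = "\<lambda>n. \<exists>xs. set xs \<subseteq> U \<union> m_inv G ` U \<and> length xs = n \<and> foldr (\<otimes>) xs \<one> = g"
  have "\<exists>xs. set xs \<subseteq> U \<union> m_inv G ` U \<and> foldr (\<otimes>) xs \<one> = g"
    using assms(2)
  proof induction
    case one
    then show ?case by (intro exI[of _ "[]"]) simp
  next
    case (incl h)
    with assms(1) show ?case by (intro exI[of _ "[h]"]) auto
  next
    case (inv h)
    with assms(1) show ?case by (intro exI[of _ "[inv h]"]) auto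
  next
    case (eng g h)
    then obtain xs ys where xy: "set xs \<subseteq> U \<union> m_inv G ` U" "foldr (\<otimes>) xs \<one> = g"
      "set ys \<subseteq> U \<union> m_inv G ` U" "foldr (\<otimes>) ys \<one> = h" by blast
    have "U \<union> m_inv G ` U \<subseteq> carrier G" using assms(1) by auto
    with xy have "foldr (\<otimes>) (xs @ ys) \<one> = g \<otimes> h"
      by (subst foldr_mult_append) auto
    with xy show ?case by (intro exI[of _ "xs @ ys"]) simp
  qed
  then have "\<exists>n. ?P n" by blast
  then have "?P (LEAST n. ?P n)" by (rule LeastI_ex)
  then show ?thesis
    using that unfolding word_length_def by blast
qed

lemma word_length_mult:
  assumes "U \<subseteq> carrier G" "g \<in> generate G U" "h \<in> generate G U"
  shows "word_length G U (g \<otimes> h) \<le> word_length G U g + word_length G U h"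
proof -
  obtain xs ys where xy: "set xs \<subseteq> U \<union> m_inv G ` U" "length xs = word_length G U g" "foldr (\<otimes>) xs \<one> = g"
    "set ys \<subseteq> U \<union> m_inv G ` U" "length ys = word_length G U h" "foldr (\<otimes>) ys \<one> = h"
    using word_length_attained[OF assms(1,2)] word_length_attained[OF assms(1,3)] by metis
  have "U \<union> m_inv G ` U \<subseteq> carrier G" using assms(1) by auto
  with xy have "foldr (\<otimes>) (xs @ ys) \<one> = g \<otimes> h"
    by (subst foldr_mult_append) auto
  with word_length_le[of "xs @ ys" U] xy show ?thesis by simp
qed

end

abbreviation word_class :: "'a set \<Rightarrow> 'a word set \<Rightarrow> 'a word \<Rightarrow> 'a word set" where
  "word_class S R w \<equiv> pres_rel S R `` {w}"

lemma carrier_presented_group: "carrier (presented_group S R) = word_class S R ` words S"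
  by (auto simp: presented_group_def quotient_def)

lemma one_presented_group: "\<one>\<^bsub>presented_group S R\<^esub> = word_class S R []"
  by (simp add: presented_group_def)

text \<open>
  Up to multiplicative constants, the word length for any finite generating set agrees with the least
  length of a word in the presentation's letters; the next two lemmas are the two directions.
\<close>

lemma word_length_le_length:
  fixes S R defines "P \<equiv> presented_group S R"
  assumes "finite S" and U: "finite_generating_set P U"
  shows "\<exists>C :: nat. \<forall>w\<in>words S. word_length P U (word_class S R w) \<le> C * length w"
proof -
  interpret group P
    unfolding P_def by (rule group_presented_group)
  have gen: "U \<subseteq> carrier P" "generate P U = carrier P"
    using U by (auto simp: finite_generating_set_def)
  have car: "word_class S R w \<in> generate P U" if "w \<in> words S" for w
    using imageI[OF that, of "word_class S R"] gen(2)
    by (simp add: P_def carrier_presented_group)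
  define C where "C = (\<Sum>x\<in>S \<times> UNIV. word_length P U (word_class S R [x]))"
  have "word_length P U (word_class S R w) \<le> C * length w" if "w \<in> words S" for w
    using that
  proof (induction w)
    case Nil
    have "word_length P U \<one>\<^bsub>P\<^esub> \<le> 0"
      using word_length_le[of "[]" U] by simp
    then show ?case by (simp add: P_def one_presented_group)
  next
    case (Cons x w)
    have "word_length P U (word_class S R [x]) \<le> C"
      unfolding C_def using Cons.prems \<open>finite S\<close>
      by (intro member_le_sum) (auto simp: mem_Times_iff)
    moreover have "word_class S R (x # w) = word_class S R [x] \<otimes>\<^bsub>P\<^esub> word_class S R w"
      using presented_group_mult[of "[x]" S w R] Cons.prems by (simp add: P_def)
    ultimately show ?case
      using word_length_mult[OF gen(1) car[of "[x]"] car[of w]] Cons by simp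
  qed
  then show ?thesis by blast
qed

lemma length_le_word_length:
  fixes S R defines "P \<equiv> presented_group S R"
  assumes U: "finite_generating_set P U"
  shows "\<exists>C :: nat. \<forall>g\<in>carrier P.
    \<exists>w\<in>words S. word_class S R w = g \<and> length w \<le> C * word_length P U g"
proof -
  interpret group P
    unfolding P_def by (rule group_presented_group)
  have gen: "U \<subseteq> carrier P" "generate P U = carrier P" "finite U"
    using U by (auto simp: finite_generating_set_def)
  let ?Y = "U \<union> m_inv P ` U"
  have "\<exists>w. w \<in> words S \<and> word_class S R w = y" if "y \<in> carrier P" for y
    using that by (auto simp: P_def carrier_presented_group)
  then obtain r where r: "\<And>y. y \<in> carrier P \<Longrightarrow> r y \<in> words S \<and> word_class S R (r y) = y"
    by metis
  define C where "C = (\<Sum>y\<in>?Y. length (r y))"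
  have Y: "?Y \<subseteq> carrier P" using gen(1) by auto
  have expand: "concat (map r ys) \<in> words S \<and> word_class S R (concat (map r ys)) = foldr (\<otimes>\<^bsub>P\<^esub>) ys \<one>\<^bsub>P\<^esub> \<and>
      length (concat (map r ys)) \<le> C * length ys" if "set ys \<subseteq> ?Y" for ys
    using that
  proof (induction ys)
    case Nil
    then show ?case by (simp add: P_def one_presented_group)
  next
    case (Cons y ys)
    have y: "r y \<in> words S" "word_class S R (r y) = y"
      using r[of y] Cons.prems Y by auto
    have "length (r y) \<le> C"
      unfolding C_def using Cons.prems gen(3) by (intro member_le_sum) auto
    moreover have "word_class S R (r y @ concat (map r ys)) = y \<otimes>\<^bsub>P\<^esub> foldr (\<otimes>\<^bsub>P\<^esub>) ys \<one>\<^bsub>P\<^esub>"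
      using presented_group_mult[of "r y" S "concat (map r ys)" R] y Cons by (simp add: P_def)
    ultimately show ?case
      using y(1) Cons by simp
  qed
  have "\<exists>w\<in>words S. word_class S R w = g \<and> length w \<le> C * word_length P U g" if g: "g \<in> carrier P" for g
  proof -
    obtain ys where "set ys \<subseteq> ?Y" "length ys = word_length P U g" "foldr (\<otimes>\<^bsub>P\<^esub>) ys \<one>\<^bsub>P\<^esub> = g"
      using word_length_attained[of U g] gen g by metis
    with expand[of ys] show ?thesis by metis
  qed
  then show ?thesis by blast
qed

section \<open>The embedding\<close>

text \<open>
  The roots for different vertices are different, so the numbers of surviving root letters add up.
\<close>

lemma (in labelled_graph) length_le_lift:
  assumes A: "finite A" and B: "set vs \<subseteq> B"
    and unf: "\<And>v. v \<in> A \<Longrightarrow> D v \<subseteq> set vs \<and> unfolds A v (D v) (t v)"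
    and w: "shortest E A w" and z: "(lift_word (set vs) w, z) \<in> raag_eq E' B"
  shows "length w \<le> length z"
proof -
  have lab_t: "lab (t v) = v \<and> t v \<in> D v" if "v \<in> A" for v
    using unf[OF that] by (auto elim!: unfolds.cases)
  have occ: "occurrences v w \<le> occurrences (t v) z" if v: "v \<in> A" for v
  proof -
    have "(restrict_word (D v) (lift_word (set vs) w), restrict_word (D v) z) \<in> raag_eq E' (D v)"
      using raag_eq_restrict[OF z, of "D v"] unf[OF v] B by auto
    then have "(lift_word (D v) w, restrict_word (D v) z) \<in> raag_eq E' (D v)"
      using restrict_lift_word[of "D v" "set vs" w] unf[OF v] by simp
    then have "occurrences v w \<le> occurrences (t v) (restrict_word (D v) z)"
      using unf[OF v] w
      by (intro occurrences_le_unfolds[of A v "D v"] shortest_imp_pinch_free) (auto simp: shortest_def)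
    also have "\<dots> \<le> occurrences (t v) z"
    proof -
      have "filter (\<lambda>x. fst x = t v) (restrict_word (D v) z) = filter (\<lambda>x. fst x = t v) z"
        using lab_t[OF v] by (auto intro: filter_cong)
      then show ?thesis by simp
    qed
    finally show ?thesis .
  qed
  have count: "(\<Sum>v\<in>F. occurrences (g v) u) = length (restrict_word (g ` F) u)"
    if "finite F" "inj_on g F" for F and g :: "'c \<Rightarrow> 'd" and u
  proof (induction u)
    case (Cons x u)
    have "(\<Sum>v\<in>F. occurrences (g v) (x # u)) =
        (\<Sum>v\<in>F. (if g v = fst x then 1 else 0)) + (\<Sum>v\<in>F. occurrences (g v) u)"
      unfolding sum.distrib[symmetric] by (intro sum.cong) auto
    also have "(\<Sum>v\<in>F. (if g v = fst x then 1 else 0)) = (\<Sum>y\<in>g ` F. (if y = fst x then 1 else (0::nat)))"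
      using that(2) by (simp add: sum.reindex)
    also have "\<dots> = (if fst x \<in> g ` F then 1 else 0)"
      using that(1) by simp
    finally show ?case using Cons by simp
  qed simp
  have "length w = (\<Sum>v\<in>A. occurrences v w)"
    using count[OF A inj_on_id, of w] w by (simp add: restrict_word_id shortest_def)
  also have "\<dots> \<le> (\<Sum>v\<in>A. occurrences (t v) z)"
    by (intro sum_mono occ)
  also have "\<dots> = length (restrict_word (t ` A) z)"
    by (rule count[OF A]) (metis inj_onI lab_t)
  also have "\<dots> \<le> length z" by simp
  finally show ?thesis .
qed

theorem theorem1:
  fixes \<Gamma> :: "'a pair_pre_digraph"
  assumes "pair_graph \<Gamma>"
  shows "\<exists>T :: nat pair_pre_digraph. finite_tree T \<and>
    (\<exists>f. \<forall>S S'. finite_generating_set (raag \<Gamma>) S \<longrightarrow> finite_generating_set (raag T) S' \<longrightarrow>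
       qi_group_embedding (raag \<Gamma>) (word_metric (raag \<Gamma>) S)
         (raag T) (word_metric (raag T) S') f)"
proof -
  obtain T :: "nat pair_pre_digraph" and lab vs D t where T: "finite_tree T"
    and lg: "labelled_graph (parcs \<Gamma>) (parcs T) lab vs" and vs: "set vs \<subseteq> pverts T"
    and unf: "\<And>v. v \<in> pverts \<Gamma> \<Longrightarrow> D v \<subseteq> set vs \<and>
      labelled_graph.unfolds (parcs \<Gamma>) (parcs T) lab (pverts \<Gamma>) v (D v) (t v)"
    using ex_tree_unfolding[OF assms] by metis
  interpret labelled_graph "parcs \<Gamma>" "parcs T" lab vs by (rule lg)
  have fin: "finite (pverts \<Gamma>)" "finite (pverts T)"
    using assms T pair_fin_digraph.pair_finite_verts
    by (auto simp: finite_tree_def pair_graph_def pair_digraph_def)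
  let ?G = "raag \<Gamma>" and ?H = "raag T"
  let ?A = "pverts \<Gamma>" and ?B = "pverts T"
  define cG where "cG = word_class ?A (raag_relators \<Gamma>)"
  define cH where "cH = word_class ?B (raag_relators T)"
  let ?lift = "lift_word (set vs)"
  have lift_words: "?lift w \<in> words ?B" for w
    using lift_word_words vs by (rule words_mono)
  have carG: "carrier ?G = cG ` words ?A" and carH: "carrier ?H = cH ` words ?B"
    by (simp_all add: cG_def cH_def raag_def carrier_presented_group)
  have oneG: "\<one>\<^bsub>?G\<^esub> = cG []" and oneH: "\<one>\<^bsub>?H\<^esub> = cH []"
    by (simp_all add: cG_def cH_def raag_def one_presented_group)
  have cG_eq: "cG v = cG w \<longleftrightarrow> (v, w) \<in> raag_eq (parcs \<Gamma>) ?A" if "v \<in> words ?A" "w \<in> words ?A" for v w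
    unfolding cG_def pres_rel_raag_relators[symmetric]
    by (rule eq_equiv_class_iff[OF equiv_pres_rel that])
  have cH_eq: "cH v = cH w \<longleftrightarrow> (v, w) \<in> raag_eq (parcs T) ?B" if "v \<in> words ?B" "w \<in> words ?B" for v w
    unfolding cH_def pres_rel_raag_relators[symmetric]
    by (rule eq_equiv_class_iff[OF equiv_pres_rel that])
  \<comment> \<open>An element of the group is a class of words; any word representing it can be lifted.\<close>
  define f where "f = (\<lambda>g. cH (?lift (SOME w. w \<in> words ?A \<and> cG w = g)))"
  have f: "f (cG w) = cH (?lift w)" if w: "w \<in> words ?A" for w
  proof -
    define w' where "w' = (SOME w'. w' \<in> words ?A \<and> cG w' = cG w)"
    have w': "w' \<in> words ?A" "cG w' = cG w"
      using someI[of "\<lambda>w'. w' \<in> words ?A \<and> cG w' = cG w" w] w by (auto simp: w'_def)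
    then have "(w', w) \<in> raag_eq (parcs \<Gamma>) ?A"
      using cG_eq w by blast
    then have "(?lift w', ?lift w) \<in> raag_eq (parcs T) ?B"
      by (rule raag_eq_mono[OF lift_eq vs]) simp
    then show ?thesis
      using cH_eq[OF lift_words lift_words] by (simp add: f_def w'_def)
  qed
  interpret G: group ?G by (rule group_raag)
  interpret H: group ?H by (rule group_raag)
  have "f \<in> hom ?G ?H"
  proof (rule homI)
    show "f g \<in> carrier ?H" if "g \<in> carrier ?G" for g
      using that lift_words by (auto simp: carG carH f)
    show "f (g \<otimes>\<^bsub>?G\<^esub> h) = f g \<otimes>\<^bsub>?H\<^esub> f h" if "g \<in> carrier ?G" "h \<in> carrier ?G" for g h
    proof -
      obtain v w where vw: "v \<in> words ?A" "w \<in> words ?A" "g = cG v" "h = cG w"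
        using \<open>g \<in> carrier ?G\<close> \<open>h \<in> carrier ?G\<close> by (auto simp: carG)
      have "cG v \<otimes>\<^bsub>?G\<^esub> cG w = cG (v @ w)"
        using presented_group_mult[OF vw(1,2)] by (simp add: cG_def raag_def)
      moreover have "cH (?lift v) \<otimes>\<^bsub>?H\<^esub> cH (?lift w) = cH (?lift v @ ?lift w)"
        using presented_group_mult[OF lift_words lift_words] by (simp add: cH_def raag_def)
      ultimately show ?thesis
        using vw by (simp add: f)
    qed
  qed
  then interpret f: group_hom ?G ?H f
    by unfold_locales
  have shortest_le: "length w \<le> length z"
    if "shortest (parcs \<Gamma>) ?A w" "z \<in> words ?B" "f (cG w) = cH z" for w z
  proof (rule length_le_lift[OF fin(1) vs unf that(1)])
    have "w \<in> words ?A" using that(1) by (simp add: shortest_def)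
    then show "(?lift w, z) \<in> raag_eq (parcs T) ?B"
      using that cH_eq[OF lift_words] by (simp add: f)
  qed
  have ex_rep: "\<exists>w. shortest (parcs \<Gamma>) ?A w \<and> cG w = g" if g: "g \<in> carrier ?G" for g
  proof -
    obtain v where v: "v \<in> words ?A" "g = cG v" using g by (auto simp: carG)
    obtain w where "(v, w) \<in> raag_eq (parcs \<Gamma>) ?A" "shortest (parcs \<Gamma>) ?A w"
      using v(1) by (rule ex_shortest)
    with v cG_eq show ?thesis by (metis shortest_def)
  qed
  have "g = \<one>\<^bsub>?G\<^esub>" if g: "g \<in> carrier ?G" "f g = \<one>\<^bsub>?H\<^esub>" for g
  proof -
    obtain w where w: "shortest (parcs \<Gamma>) ?A w" "cG w = g"
      using ex_rep[OF g(1)] by blast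
    have "length w \<le> length ([] :: nat word)"
      by (rule shortest_le[OF w(1)]) (use w g in \<open>auto simp: oneH\<close>)
    with w show ?thesis by (simp add: oneG)
  qed
  then have mon: "f \<in> mon ?G ?H"
    using f.homh by (simp add: mon_iff_hom_one G.is_group H.is_group)
  have "qi_group_embedding ?G (word_metric ?G S) ?H (word_metric ?H S') f"
    if S: "finite_generating_set ?G S" and S': "finite_generating_set ?H S'" for S S'
  proof -
    obtain C1 :: nat where C1: "\<And>w. w \<in> words ?A \<Longrightarrow> word_length ?G S (cG w) \<le> C1 * length w"
      using word_length_le_length[OF fin(1) S[unfolded raag_def]]
      unfolding cG_def raag_def by blast
    obtain C2 :: nat where C2: "\<And>g. g \<in> carrier ?G \<Longrightarrow>
        \<exists>w\<in>words ?A. cG w = g \<and> length w \<le> C2 * word_length ?G S g"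
      using length_le_word_length[OF S[unfolded raag_def]]
      unfolding cG_def raag_def by blast
    obtain C3 :: nat where C3: "\<And>w. w \<in> words ?B \<Longrightarrow> word_length ?H S' (cH w) \<le> C3 * length w"
      using word_length_le_length[OF fin(2) S'[unfolded raag_def]]
      unfolding cH_def raag_def by blast
    obtain C4 :: nat where C4: "\<And>g. g \<in> carrier ?H \<Longrightarrow>
        \<exists>w\<in>words ?B. cH w = g \<and> length w \<le> C4 * word_length ?H S' g"
      using length_le_word_length[OF S'[unfolded raag_def]]
      unfolding cH_def raag_def by blast
    have lower: "word_length ?G S g \<le> C1 * C4 * word_length ?H S' (f g)" if g: "g \<in> carrier ?G" for g
    proof -
      obtain w where w: "shortest (parcs \<Gamma>) ?A w" "cG w = g"
        using ex_rep[OF g] by blast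
      obtain z where z: "z \<in> words ?B" "cH z = f g" "length z \<le> C4 * word_length ?H S' (f g)"
        using C4[of "f g"] g by auto
      have "word_length ?G S g \<le> C1 * length w"
        using C1[of w] w by (auto simp: shortest_def)
      also have "\<dots> \<le> C1 * length z"
        using shortest_le[OF w(1) z(1)] w(2) z(2) by simp
      also have "\<dots> \<le> C1 * (C4 * word_length ?H S' (f g))"
        using z(3) by simp
      finally show ?thesis by (simp add: mult.assoc)
    qed
    have upper: "word_length ?H S' (f g) \<le> C3 * length vs * C2 * word_length ?G S g"
      if g: "g \<in> carrier ?G" for g
    proof -
      obtain w where w: "w \<in> words ?A" "cG w = g" "length w \<le> C2 * word_length ?G S g"
        using C2[OF g] by blast
      have lift_length: "length (?lift u) \<le> length vs * length u" for u
      proof (induction u)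
        case (Cons x u)
        have "length (lift (set vs) x) \<le> length vs" by (simp add: lift_def)
        with Cons show ?case by simp
      qed simp
      have "word_length ?H S' (f g) \<le> C3 * length (?lift w)"
        using C3[OF lift_words, of w] f[OF w(1)] w(2) by simp
      also have "\<dots> \<le> C3 * (length vs * length w)"
        using lift_length by simp
      also have "\<dots> \<le> C3 * (length vs * (C2 * word_length ?G S g))"
        using w(3) by (intro mult_le_mono2)
      finally show ?thesis by (simp add: mult.assoc)
    qed
    define C where "C = real (C1 * C4 + C3 * length vs * C2 + 1)"
    have "word_metric ?G S x y / C - C \<le> word_metric ?H S' (f x) (f y) \<and>
        word_metric ?H S' (f x) (f y) \<le> C * word_metric ?G S x y + C"
      if xy: "x \<in> carrier ?G" "y \<in> carrier ?G" for x y
    proof -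
      define g where "g = inv\<^bsub>?G\<^esub> x \<otimes>\<^bsub>?G\<^esub> y"
      have g: "g \<in> carrier ?G" using xy by (simp add: g_def)
      have fg: "inv\<^bsub>?H\<^esub> (f x) \<otimes>\<^bsub>?H\<^esub> f y = f g"
        using xy by (simp add: g_def)
      let ?l = "word_length ?G S g" and ?l' = "word_length ?H S' (f g)"
      have "?l \<le> (C1 * C4 + C3 * length vs * C2 + 1) * ?l'"
        by (rule order.trans[OF lower[OF g]]) (intro mult_le_mono1, simp)
      then have "real ?l \<le> C * real ?l'"
        unfolding C_def of_nat_mult[symmetric] of_nat_le_iff .
      moreover have "?l' \<le> (C1 * C4 + C3 * length vs * C2 + 1) * ?l"
        by (rule order.trans[OF upper[OF g]]) (intro mult_le_mono1, simp)
      then have "real ?l' \<le> C * real ?l"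
        unfolding C_def of_nat_mult[symmetric] of_nat_le_iff .
      moreover have "C > 0" unfolding C_def of_nat_0_less_iff by simp
      moreover from calculation have "real ?l / C \<le> real ?l'"
        by (simp add: divide_le_eq mult.commute)
      ultimately show ?thesis
        unfolding word_metric_def fg g_def[symmetric] by linarith
    qed
    moreover have "C > 0" unfolding C_def of_nat_0_less_iff by simp
    ultimately show ?thesis
      unfolding qi_group_embedding_def using mon by blast
  qed
  with T show ?thesis by blast
qed

end
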